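(* Let $\langle\cdot\rangle$ be either the space-time average or the ensemble average (see the context). If a covering by the averaging time intervals $T$ and the space regions $S$ is determined through the cosmological fluid configuration, then the averaged system of the Navier-Stokes-Poisson equations in terms of the kinematic quantities is as follows. (1) Averaged Raychaudhuri evolution equation for the averaged expansion scalar: $$\frac{d\langle\theta\rangle}{dt}+\Big\langle u^i\frac{\partial\theta}{\partial x^i}\Big\rangle-\langle u^i\rangle\frac{\partial\langle\theta\rangle}{\partial x^i}+\tfrac13\langle\theta^2\rangle+2(\langle\sigma^2\rangle-\langle\omega^2\rangle)+4\pi G\langle\rho\rangle-\Lambda-\delta^{ij}\langle A_i\rangle_{,j}=0.$$ (2) Averaged propagation equation for the averaged shear tensor: $$\frac{d\langle\sigma_{ij}\rangle}{dt}+\Big\langle u^k\frac{\partial\sigma_{ij}}{\partial x^k}\Big\rangle-\langle u^k\rangle\frac{\partial\langle\sigma_{ij}\rangle}{\partial x^k}+\delta^{kl}\langle\sigma_{ik}\sigma_{lj}\rangle+\tfrac23\langle\theta\sigma_{ij}\rangle-\tfrac13\delta_{ij}(2\langle\sigma^2\rangle+\langle\omega^2\rangle-\delta^{kl}\langle A_k\rangle_{,l})+\langle\omega_i\omega_j\rangle+\langle E_{ij}\rangle-\langle A_{(i}\rangle_{,j)}=0.$$ (3) Averaged propagation equation for the averaged vorticity vector: $$\frac{d\langle\omega^i\rangle}{dt}+\Big\langle u^j\frac{\partial\omega^i}{\partial x^j}\Big\rangle-\langle u^j\rangle\frac{\partial\langle\omega^i\rangle}{\partial x^j}+\tfrac23\langle\theta\omega^i\rangle-\delta^{ij}\langle\sigma_{jk}\omega^k\rangle-\tfrac12\varepsilon^{ijk}\langle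 A_j\rangle_{,k}=0.$$ (4) Averaged kinematic decomposition: $\langle u_i\rangle_{,j}=\langle\sigma_{ij}\rangle+\frac13\delta_{ij}\langle\theta\rangle+\langle\omega_{ij}\rangle$, $\langle\sigma_{ij}\rangle=\langle\sigma_{ji}\rangle$, $\langle\theta\rangle=\delta^{ij}\langle u_i\rangle_{,j}$, $\langle\omega_{ij}\rangle=-\langle\omega_{ji}\rangle$. (5) Averaged first identity: $\langle u_i\rangle_{,jt}=\langle u_i\rangle_{,tj}$. (6) Averaged second identity: $\langle u_i\rangle_{,jk}=\langle u_i\rangle_{,kj}$. (7) Averaged first constraint equation: $\delta^{jk}(\langle\sigma_{ij}\rangle_{,k}-\langle\omega_{ij}\rangle_{,k})-\frac23\langle\theta\rangle_{,i}=0$. (8) Averaged second constraint equation: $\langle\omega^i\rangle_{,i}=0$. (9) Averaged third constraint equation: $\delta^{j(i}(\langle\sigma_{jk}\rangle_{,l}+\langle\omega_{jk}\rangle_{,l})\varepsilon^{m)kl}=0$. (10) Averaged first integrability condition: $\langle E_i^j\rangle_{,j}=\frac{8\pi G}{3}\langle\rho\rangle_{,i}$. (11) Averaged second integrability condition: $\langle E_k^{(i}\rangle_{,j}\varepsilon^{l)kj}=0$. (12) Averaged third integrability condition: $\langle\sigma^{[i}_{[k}\rangle^{,j]}_{,l]}+\frac23\delta^{[i}_{[k}\langle\theta\rangle^{,j]}_{,l]}=0$. (13) Averaged equation of continuity: $$\frac{d\langle\rho\rangle}{dt}+\Big\langle u^i\frac{\partial\rho}{\partial x^i}\Big\rangle-\langle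 u^i\rangle\frac{\partial\langle\rho\rangle}{\partial x^i}+\langle\rho\theta\rangle=0.$$ (14) Averaged equation of state: $\langle\rho\rangle=\langle\rho(p)\rangle$. (15) Averaged total acceleration by the averaged Navier-Stokes equation: $\langle A_i\rangle=-\big\langle\frac1\rho p_{,i}\big\rangle$. (16) Averaged Poisson equation: $\delta^{ij}\langle g_i\rangle_{,j}=4\pi G\langle\rho\rangle-\Lambda$, or $\delta^{ij}\langle\phi\rangle_{,ij}=4\pi G\langle\rho\rangle-\Lambda$. (17) Averaged identity for the averaged gravitational acceleration: $\varepsilon^{ijk}\langle g_j\rangle_{,k}=0$. (18) Averaged tidal force tensor: $\langle E_{ij}\rangle=\langle\phi\rangle_{,ij}-\frac13\delta_{ij}\delta^{kl}\langle\phi\rangle_{,kl}$, $\langle E_{ij}\rangle=\langle E_{ji}\rangle$, $\delta^{kl}\langle E_{kl}\rangle=0$. (19) Averaged evolution equations for the averaged tidal force tensor: $$\frac{d\langle E_{ij}\rangle}{dt}+\Big\langle u^k\frac{\partial E_{ij}}{\partial x^k}\Big\rangle-\langle u^k\rangle\frac{\partial\langle E_{ij}\rangle}{\partial x^k}+\langle\theta E_{ij}\rangle-\delta_{ij}\delta^{kn}\delta^{lm}\langle\sigma_{kl}E_{nm}\rangle-3\delta^{kl}\langle\sigma_{k(i}E_{j)l}\rangle-\delta^{kl}\langle\omega_{k(i}E_{j)l}\rangle+4\pi G\langle\rho\sigma_{ij}\rangle=0.$$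
   Context: Conventions: Latin indices run over $1,2,3$ in Cartesian coordinates $x^i$ of Euclidean space $E^3$, are raised and lowered with the Kronecker symbol, and are summed when repeated; $_{,i}=\partial/\partial x^i$, $_{,t}=\partial/\partial t$; round (square) brackets on indices denote symmetrization (antisymmetrization) with factor $\frac12$, the upper and the lower pair separately in (12); $\varepsilon^{ijk}$ is the Levi-Civita symbol with $\varepsilon^{123}=+1$. $G$ is the Newton gravitational constant and $\Lambda$ the Newtonian cosmological constant. Averages: the space-time average is $\langle f\rangle(x^i,t)=\frac{1}{TV_S}\int_T\int_S f(x^i+x'^i,t+t')\,dt'\,dV'$, where $T$ is a time interval (and its length) and $S\subset E^3$ a space region of volume $V_S$. A covering means that such $T$ and $S$ are prescribed at every time and every position, all of the same shape and volume, so that $T$ and $V_S$ have vanishing derivatives with respect to $t$ and $x^i$. The ensemble average is $\langle f\rangle(x^i,t)=\int_{-\infty}^{+\infty}f\,P_{(x^i,t)}(f)\,df$, with $P_{(x^i,t)}$ the probability density of the value $f(x^i,t)$ of the random field $f$; averages of products are taken with the joint probability densities. The average of a product of fields is the single-point moment, all factors being taken at the same $(x^i,t)$. The material derivative of an averaged field is $\frac{d\langle f\rangle}{dt}=\langle f\rangle_{,t}+\langle u^k\rangle\langle f\rangle_{,k}$; for an unaveraged field $\frac{df}{dt}=f_{,t}+u^kf_{,k}$. Fields: $u^i$ fluid velocity, $\rho$ fluid density, $p$ fluid pressure, $\phi$ Newtonian gravitational potential, $g_i=\phi_{,i}$ gravitational acceleration (in the sign convention of (16)), $\theta$ expansion scalar,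 $\sigma_{ij}$ shear tensor, $\omega_{ij}$ vorticity tensor (the trace, symmetric trace-free and antisymmetric parts of $u_{i,j}$), $\omega^i=\frac12\varepsilon^{ijk}\omega_{jk}$ vorticity vector, $\sigma^2=\frac12\sigma_{ij}\sigma^{ij}$, $\omega^2=\omega_i\omega^i$, $A_i=\frac{du_i}{dt}+\phi_{,i}$ total acceleration, $E_{ij}$ tidal force tensor. Unaveraged system: the Navier-Stokes-Poisson equations in terms of the kinematic quantities, which the fields are assumed to satisfy, are the equations obtained from (1)-(19) by removing all average brackets $\langle\cdot\rangle$ (so that, for example, (13) becomes $\frac{d\rho}{dt}+\rho\theta=0$).
   Formalization: Assumed: fields on all of E^3 x R, u and φ of class C^3, ρ and p of class C^1; T and S bounded, carried by translation; for the ensemble, u, φ, ρ, A_i and their derivatives locally dominated by integrable random variables, and the averages of the occurring products exist. *)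

theory Defs
  imports "HOL-Probability.Probability"
begin

type_synonym field = "real^3 \<Rightarrow> real \<Rightarrow> real"

definition pd :: "3 \<Rightarrow> field \<Rightarrow> field" where
  "pd i f = (\<lambda>x t. deriv (\<lambda>s. f (x + s *\<^sub>R axis i 1) t) 0)"

definition td :: "field \<Rightarrow> field" where
  "td f = (\<lambda>x t. deriv (\<lambda>s. f x s) t)"

text \<open>Class $C^k$ on $E^3 \times R$, through iterated partial derivatives in the four coordinates.\<close>

fun Ck :: "nat \<Rightarrow> field \<Rightarrow> bool" where
  "Ck 0 f \<longleftrightarrow> continuous_on UNIV (\<lambda>(x, t). f x t)"
| "Ck (Suc k) f \<longleftrightarrow>
     continuous_on UNIV (\<lambda>(x, t). f x t) \<and>
     (\<forall>i x t. (\<lambda>s. f (x + s *\<^sub>R axis i 1) t) differentiable at 0) \<and>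
     (\<forall>x t. (\<lambda>s. f x s) differentiable at t) \<and>
     (\<forall>i. Ck k (pd i f)) \<and> Ck k (td f)"

definition kd :: "3 \<Rightarrow> 3 \<Rightarrow> real" where
  "kd i j = (if i = j then 1 else 0)"

definition eps :: "3 \<Rightarrow> 3 \<Rightarrow> 3 \<Rightarrow> real" where
  "eps i j k =
     (if (i, j, k) \<in> {(1, 2, 3), (2, 3, 1), (3, 1, 2)} then 1
      else if (i, j, k) \<in> {(3, 2, 1), (2, 1, 3), (1, 3, 2)} then - 1
      else 0)"

record fluid =
  velocity :: "real^3 \<Rightarrow> real \<Rightarrow> real^3"
  density :: field
  pressure :: field
  potential :: field

type_synonym quantity = "fluid \<Rightarrow> field"

definition vel :: "3 \<Rightarrow> quantity" where
  "vel i F = (\<lambda>x t. velocity F x t $ i)"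

definition expansion :: quantity where
  "expansion F = (\<lambda>x t. \<Sum>i\<in>UNIV. pd i (vel i F) x t)"

definition shear :: "3 \<Rightarrow> 3 \<Rightarrow> quantity" where
  "shear i j F = (\<lambda>x t. (pd j (vel i F) x t + pd i (vel j F) x t) / 2
                        - 1/3 * kd i j * expansion F x t)"

definition vorticity :: "3 \<Rightarrow> 3 \<Rightarrow> quantity" where
  "vorticity i j F = (\<lambda>x t. (pd j (vel i F) x t - pd i (vel j F) x t) / 2)"

definition vort_vec :: "3 \<Rightarrow> quantity" where
  "vort_vec i F = (\<lambda>x t. 1/2 * (\<Sum>j\<in>UNIV. \<Sum>k\<in>UNIV. eps i j k * vorticity j k F x t))"

definition shear_sq :: quantity where
  "shear_sq F = (\<lambda>x t. 1/2 * (\<Sum>i\<in>UNIV. \<Sum>j\<in>UNIV. shear i j F x t * shear i j F x t))"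

definition vort_sq :: quantity where
  "vort_sq F = (\<lambda>x t. \<Sum>i\<in>UNIV. vort_vec i F x t * vort_vec i F x t)"

definition grav :: "3 \<Rightarrow> quantity" where
  "grav i F = pd i (potential F)"

definition total_acc :: "3 \<Rightarrow> quantity" where
  "total_acc i F = (\<lambda>x t. td (vel i F) x t + (\<Sum>k\<in>UNIV. vel k F x t * pd k (vel i F) x t)
                          + pd i (potential F) x t)"

definition tidal :: "3 \<Rightarrow> 3 \<Rightarrow> quantity" where
  "tidal i j F = (\<lambda>x t. pd j (pd i (potential F)) x t
     - 1/3 * kd i j * (\<Sum>k\<in>UNIV. \<Sum>l\<in>UNIV. kd k l * pd l (pd k (potential F)) x t))"

text \<open>
  A bracket operator \<open>B\<close> sends a quantity to its (averaged) field.  With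
  \<open>B = (\<lambda>q. q F)\<close> all brackets disappear, so that one definition of the system covers both the
  unaveraged and the averaged equations.  A comma outside a bracket is a derivative applied to
  \<open>B q\<close>, and one inside a bracket is a derivative inside the argument of \<open>B\<close>.  Subscripts after
  a comma act from left to right: $f_{,ij}$ is \<open>pd j (pd i f)\<close>.
\<close>

type_synonym bracket = "quantity \<Rightarrow> field"

definition mat_deriv :: "bracket \<Rightarrow> quantity \<Rightarrow> field" where
  "mat_deriv B q = (\<lambda>x t. td (B q) x t + (\<Sum>k\<in>UNIV. B (vel k) x t * pd k (B q) x t))"

text \<open>The advection correction $\langle u^k q_{,k}\rangle - \langle u^k\rangle\langle q\rangle_{,k}$.\<close>

definition adv_corr :: "bracket \<Rightarrow> quantity \<Rightarrow> field" where
  "adv_corr B q = (\<lambda>x t. B (\<lambda>F x t. \<Sum>k\<in>UNIV. vel k F x t * pd k (q F) x t) x t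
                         - (\<Sum>k\<in>UNIV. B (vel k) x t * pd k (B q) x t))"

definition sym2 :: "(3 \<Rightarrow> 3 \<Rightarrow> real) \<Rightarrow> 3 \<Rightarrow> 3 \<Rightarrow> real" where
  "sym2 a i j = (a i j + a j i) / 2"

definition asym22 :: "(3 \<Rightarrow> 3 \<Rightarrow> 3 \<Rightarrow> 3 \<Rightarrow> real) \<Rightarrow> 3 \<Rightarrow> 3 \<Rightarrow> 3 \<Rightarrow> 3 \<Rightarrow> real" where
  "asym22 a i j k l = (a i j k l - a j i k l - a i j l k + a j i l k) / 4"

definition raychaudhuri :: "real \<Rightarrow> real \<Rightarrow> bracket \<Rightarrow> bool" where
  "raychaudhuri G \<Lambda> B \<longleftrightarrow> (\<forall>x t.
     mat_deriv B expansion x t + adv_corr B expansion x t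
     + 1/3 * B (\<lambda>F x t. (expansion F x t)\<^sup>2) x t
     + 2 * (B shear_sq x t - B vort_sq x t)
     + 4 * pi * G * B density x t - \<Lambda>
     - (\<Sum>i\<in>UNIV. \<Sum>j\<in>UNIV. kd i j * pd j (B (total_acc i)) x t) = 0)"

definition shear_propagation :: "bracket \<Rightarrow> bool" where
  "shear_propagation B \<longleftrightarrow> (\<forall>i j x t.
     mat_deriv B (shear i j) x t + adv_corr B (shear i j) x t
     + (\<Sum>k\<in>UNIV. \<Sum>l\<in>UNIV. kd k l * B (\<lambda>F x t. shear i k F x t * shear l j F x t) x t)
     + 2/3 * B (\<lambda>F x t. expansion F x t * shear i j F x t) x t
     - 1/3 * kd i j * (2 * B shear_sq x t + B vort_sq x t
         - (\<Sum>k\<in>UNIV. \<Sum>l\<in>UNIV. kd k l * pd l (B (total_acc k)) x t))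
     + B (\<lambda>F x t. vort_vec i F x t * vort_vec j F x t) x t
     + B (tidal i j) x t
     - sym2 (\<lambda>i j. pd j (B (total_acc i)) x t) i j = 0)"

definition vorticity_propagation :: "bracket \<Rightarrow> bool" where
  "vorticity_propagation B \<longleftrightarrow> (\<forall>i x t.
     mat_deriv B (vort_vec i) x t + adv_corr B (vort_vec i) x t
     + 2/3 * B (\<lambda>F x t. expansion F x t * vort_vec i F x t) x t
     - (\<Sum>j\<in>UNIV. kd i j * B (\<lambda>F x t. \<Sum>k\<in>UNIV. shear j k F x t * vort_vec k F x t) x t)
     - 1/2 * (\<Sum>j\<in>UNIV. \<Sum>k\<in>UNIV. eps i j k * pd k (B (total_acc j)) x t) = 0)"

definition kinematic_decomposition :: "bracket \<Rightarrow> bool" where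
  "kinematic_decomposition B \<longleftrightarrow>
     (\<forall>i j x t. pd j (B (vel i)) x t
        = B (shear i j) x t + 1/3 * kd i j * B expansion x t + B (vorticity i j) x t) \<and>
     (\<forall>i j x t. B (shear i j) x t = B (shear j i) x t) \<and>
     (\<forall>x t. B expansion x t = (\<Sum>i\<in>UNIV. \<Sum>j\<in>UNIV. kd i j * pd j (B (vel i)) x t)) \<and>
     (\<forall>i j x t. B (vorticity i j) x t = - B (vorticity j i) x t)"

definition first_identity :: "bracket \<Rightarrow> bool" where
  "first_identity B \<longleftrightarrow>
     (\<forall>i j x t. td (pd j (B (vel i))) x t = pd j (td (B (vel i))) x t)"

definition second_identity :: "bracket \<Rightarrow> bool" where
  "second_identity B \<longleftrightarrow>
     (\<forall>i j k x t. pd k (pd j (B (vel i))) x t = pd j (pd k (B (vel i))) x t)"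

definition first_constraint :: "bracket \<Rightarrow> bool" where
  "first_constraint B \<longleftrightarrow> (\<forall>i x t.
     (\<Sum>j\<in>UNIV. \<Sum>k\<in>UNIV. kd j k * (pd k (B (shear i j)) x t - pd k (B (vorticity i j)) x t))
     - 2/3 * pd i (B expansion) x t = 0)"

definition second_constraint :: "bracket \<Rightarrow> bool" where
  "second_constraint B \<longleftrightarrow> (\<forall>x t. (\<Sum>i\<in>UNIV. pd i (B (vort_vec i)) x t) = 0)"

definition third_constraint :: "bracket \<Rightarrow> bool" where
  "third_constraint B \<longleftrightarrow> (\<forall>i m x t.
     sym2 (\<lambda>i m. \<Sum>j\<in>UNIV. \<Sum>k\<in>UNIV. \<Sum>l\<in>UNIV.
       kd j i * (pd l (B (shear j k)) x t + pd l (B (vorticity j k)) x t) * eps m k l) i m = 0)"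

definition first_integrability :: "real \<Rightarrow> bracket \<Rightarrow> bool" where
  "first_integrability G B \<longleftrightarrow> (\<forall>i x t.
     (\<Sum>j\<in>UNIV. pd j (B (tidal i j)) x t) = 8 * pi * G / 3 * pd i (B density) x t)"

definition second_integrability :: "bracket \<Rightarrow> bool" where
  "second_integrability B \<longleftrightarrow> (\<forall>i l x t.
     sym2 (\<lambda>i l. \<Sum>j\<in>UNIV. \<Sum>k\<in>UNIV. pd j (B (tidal k i)) x t * eps l k j) i l = 0)"

definition third_integrability :: "bracket \<Rightarrow> bool" where
  "third_integrability B \<longleftrightarrow> (\<forall>i j k l x t.
     asym22 (\<lambda>i j k l. pd l (pd j (B (shear i k))) x t) i j k l
     + 2/3 * asym22 (\<lambda>i j k l. kd i k * pd l (pd j (B expansion)) x t) i j k l = 0)"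

definition continuity_equation :: "bracket \<Rightarrow> bool" where
  "continuity_equation B \<longleftrightarrow> (\<forall>x t.
     mat_deriv B density x t + adv_corr B density x t
     + B (\<lambda>F x t. density F x t * expansion F x t) x t = 0)"

definition state_equation :: "(real \<Rightarrow> real) \<Rightarrow> bracket \<Rightarrow> bool" where
  "state_equation \<rho>\<^sub>p B \<longleftrightarrow> (\<forall>x t. B density x t = B (\<lambda>F x t. \<rho>\<^sub>p (pressure F x t)) x t)"

definition navier_stokes :: "bracket \<Rightarrow> bool" where
  "navier_stokes B \<longleftrightarrow> (\<forall>i x t.
     B (total_acc i) x t = - B (\<lambda>F x t. 1 / density F x t * pd i (pressure F) x t) x t)"

definition poisson_equation :: "real \<Rightarrow> real \<Rightarrow> bracket \<Rightarrow> bool" where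
  "poisson_equation G \<Lambda> B \<longleftrightarrow>
     (\<forall>x t. (\<Sum>i\<in>UNIV. \<Sum>j\<in>UNIV. kd i j * pd j (B (grav i)) x t)
        = 4 * pi * G * B density x t - \<Lambda>) \<and>
     (\<forall>x t. (\<Sum>i\<in>UNIV. \<Sum>j\<in>UNIV. kd i j * pd j (pd i (B potential)) x t)
        = 4 * pi * G * B density x t - \<Lambda>)"

definition grav_identity :: "bracket \<Rightarrow> bool" where
  "grav_identity B \<longleftrightarrow> (\<forall>i x t.
     (\<Sum>j\<in>UNIV. \<Sum>k\<in>UNIV. eps i j k * pd k (B (grav j)) x t) = 0)"

definition tidal_tensor :: "bracket \<Rightarrow> bool" where
  "tidal_tensor B \<longleftrightarrow>
     (\<forall>i j x t. B (tidal i j) x t = pd j (pd i (B potential)) x t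
        - 1/3 * kd i j * (\<Sum>k\<in>UNIV. \<Sum>l\<in>UNIV. kd k l * pd l (pd k (B potential)) x t)) \<and>
     (\<forall>i j x t. B (tidal i j) x t = B (tidal j i) x t) \<and>
     (\<forall>x t. (\<Sum>k\<in>UNIV. \<Sum>l\<in>UNIV. kd k l * B (tidal k l) x t) = 0)"

definition tidal_evolution :: "real \<Rightarrow> bracket \<Rightarrow> bool" where
  "tidal_evolution G B \<longleftrightarrow> (\<forall>i j x t.
     mat_deriv B (tidal i j) x t + adv_corr B (tidal i j) x t
     + B (\<lambda>F x t. expansion F x t * tidal i j F x t) x t
     - kd i j * (\<Sum>k\<in>UNIV. \<Sum>l\<in>UNIV. \<Sum>m\<in>UNIV. \<Sum>n\<in>UNIV.
         kd k n * kd l m * B (\<lambda>F x t. shear k l F x t * tidal n m F x t) x t)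
     - 3 * (\<Sum>k\<in>UNIV. \<Sum>l\<in>UNIV. kd k l *
         B (\<lambda>F x t. sym2 (\<lambda>i j. shear k i F x t * tidal j l F x t) i j) x t)
     - (\<Sum>k\<in>UNIV. \<Sum>l\<in>UNIV. kd k l *
         B (\<lambda>F x t. sym2 (\<lambda>i j. vorticity k i F x t * tidal j l F x t) i j) x t)
     + 4 * pi * G * B (\<lambda>F x t. density F x t * shear i j F x t) x t = 0)"

definition nsp_system :: "real \<Rightarrow> real \<Rightarrow> (real \<Rightarrow> real) \<Rightarrow> bracket \<Rightarrow> bool" where
  "nsp_system G \<Lambda> \<rho>\<^sub>p B \<longleftrightarrow>
     raychaudhuri G \<Lambda> B \<and>
     shear_propagation B \<and>
     vorticity_propagation B \<and>
     kinematic_decomposition B \<and>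
     first_identity B \<and>
     second_identity B \<and>
     first_constraint B \<and>
     second_constraint B \<and>
     third_constraint B \<and>
     first_integrability G B \<and>
     second_integrability B \<and>
     third_integrability B \<and>
     continuity_equation B \<and>
     state_equation \<rho>\<^sub>p B \<and>
     navier_stokes B \<and>
     poisson_equation G \<Lambda> B \<and>
     grav_identity B \<and>
     tidal_tensor B \<and>
     tidal_evolution G B"

text \<open>
  \<open>deriv\<close> is total, so the derivatives in the system are meaningful only where they exist; this
  predicate says that every bracket differentiated in the system has continuous derivatives up to
  the order used there.
\<close>

definition brackets_differentiable :: "bracket \<Rightarrow> bool" where
  "brackets_differentiable B \<longleftrightarrow>
     (\<forall>i. Ck 2 (B (vel i))) \<and> Ck 2 (B potential) \<and> Ck 1 (B density) \<and>
     (\<forall>i. Ck 1 (B (total_acc i))) \<and>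
     Ck 2 (B expansion) \<and> (\<forall>i j. Ck 2 (B (shear i j))) \<and>
     (\<forall>i j. Ck 1 (B (vorticity i j))) \<and> (\<forall>i. Ck 1 (B (vort_vec i))) \<and>
     (\<forall>i. Ck 1 (B (grav i))) \<and> (\<forall>i j. Ck 1 (B (tidal i j)))"

text \<open>The orders are those of the derivatives of the four fields occurring in the system.\<close>

definition regular_fluid :: "fluid \<Rightarrow> bool" where
  "regular_fluid F \<longleftrightarrow>
     (\<forall>i. Ck 3 (vel i F)) \<and> Ck 3 (potential F) \<and> Ck 1 (density F) \<and> Ck 1 (pressure F)"

text \<open>
  \<open>T x t\<close> and \<open>S x t\<close> are the averaging interval and region prescribed at \<open>(x, t)\<close>, given by the
  displacements $t'$ and $x'$ from that point.  In these relative coordinates, regions of the same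
  shape and volume, carried along by translation, are equal sets.  If the regions were allowed to
  rotate from point to point, averages would not commute with derivatives.
\<close>

definition covering ::
    "(real^3 \<Rightarrow> real \<Rightarrow> real set) \<Rightarrow> (real^3 \<Rightarrow> real \<Rightarrow> (real^3) set) \<Rightarrow> bool" where
  "covering T S \<longleftrightarrow>
     (\<forall>x t. is_interval (T x t) \<and> bounded (T x t) \<and> 0 < measure lborel (T x t)) \<and>
     (\<forall>x t. S x t \<in> sets borel \<and> bounded (S x t) \<and> 0 < measure lborel (S x t)) \<and>
     (\<forall>x t y s. T x t = T y s \<and> S x t = S y s)"

definition spacetime_avg ::
    "(real^3 \<Rightarrow> real \<Rightarrow> real set) \<Rightarrow> (real^3 \<Rightarrow> real \<Rightarrow> (real^3) set) \<Rightarrow> field \<Rightarrow> field" where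
  "spacetime_avg T S f = (\<lambda>x t.
     1 / (measure lborel (T x t) * measure lborel (S x t)) *
     (LINT t':T x t|lborel. LINT x':S x t|lborel. f (x + x') (t + t')))"

text \<open>
  A random field is a family of fields indexed by the realizations \<open>w\<close> of a probability space \<open>M\<close>.
  $P_{(x,t)}(f)\,df$ is read as the probability law of the value of the field at \<open>(x, t)\<close>, which
  need not be absolutely continuous (deterministic or linearly dependent fields have no joint
  density).  The two lemmas below recover the formulas with densities and joint densities.
\<close>

definition ensemble_avg :: "'w measure \<Rightarrow> ('w \<Rightarrow> field) \<Rightarrow> field" where
  "ensemble_avg M f = (\<lambda>x t. \<integral>y. y \<partial>distr M borel (\<lambda>w. f w x t))"

lemma ensemble_avg_density:
  assumes "distributed M lborel (\<lambda>w. f w x t) (\<lambda>y. ennreal (P y))" and "\<And>y. 0 \<le> P y"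
  shows "ensemble_avg M f x t = (\<integral>y. y * P y \<partial>lborel)"
proof -
  have m: "(\<lambda>w. f w x t) \<in> borel_measurable M"
    using distributed_measurable[OF assms(1)] by simp
  have "ensemble_avg M f x t = (\<integral>w. f w x t \<partial>M)"
    unfolding ensemble_avg_def by (rule integral_distr[OF m]) simp
  also have "\<dots> = (\<integral>y. P y * y \<partial>lborel)"
    by (rule distributed_integral[OF assms(1), symmetric]) (use assms(2) in auto)
  finally show ?thesis by (simp add: mult.commute)
qed

lemma ensemble_avg_product_density:
  assumes "distributed M (lborel \<Otimes>\<^sub>M lborel) (\<lambda>w. (f w x t, g w x t)) (\<lambda>z. ennreal (P z))"
    and "\<And>z. 0 \<le> P z"
  shows "ensemble_avg M (\<lambda>w x t. f w x t * g w x t) x t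
           = (\<integral>z. fst z * snd z * P z \<partial>(lborel \<Otimes>\<^sub>M lborel))"
proof -
  have m: "(\<lambda>w. (f w x t, g w x t)) \<in> M \<rightarrow>\<^sub>M lborel \<Otimes>\<^sub>M lborel"
    using distributed_measurable[OF assms(1)] .
  have "(\<lambda>w. f w x t) \<in> borel_measurable M" "(\<lambda>w. g w x t) \<in> borel_measurable M"
    using measurable_compose[OF m measurable_fst] measurable_compose[OF m measurable_snd]
    by simp_all
  then have "(\<lambda>w. f w x t * g w x t) \<in> borel_measurable M"
    by measurable
  then have "ensemble_avg M (\<lambda>w x t. f w x t * g w x t) x t = (\<integral>w. f w x t * g w x t \<partial>M)"
    unfolding ensemble_avg_def by (intro integral_distr) simp_all
  also have "\<dots> = (\<integral>z. P z * (fst z * snd z) \<partial>(lborel \<Otimes>\<^sub>M lborel))"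
  proof -
    have "(\<lambda>z::real \<times> real. fst z * snd z) \<in> borel_measurable (lborel \<Otimes>\<^sub>M lborel)"
      by measurable
    from distributed_integral[OF assms(1) this] assms(2) show ?thesis
      by simp
  qed
  finally show ?thesis by (simp add: mult.commute)
qed

text \<open>
  The standard condition under which an expectation may be differentiated with respect to the
  parameters \<open>x\<close> and \<open>t\<close>: locally in \<open>(x, t)\<close>, the field and its derivatives are dominated by an
  integrable random variable.
\<close>

definition locally_dominated :: "'w measure \<Rightarrow> ('w \<Rightarrow> field) \<Rightarrow> bool" where
  "locally_dominated M f \<longleftrightarrow> (\<forall>x t.
     (\<lambda>w. f w x t) \<in> borel_measurable M \<and>
     (\<exists>r>0. \<exists>Z. integrable M Z \<and>
        (\<forall>w\<in>space M. \<forall>y s. dist y x < r \<longrightarrow> dist s t < r \<longrightarrow> \<bar>f w y s\<bar> \<le> Z w)))"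

fun dominated_Ck :: "'w measure \<Rightarrow> nat \<Rightarrow> ('w \<Rightarrow> field) \<Rightarrow> bool" where
  "dominated_Ck M 0 f \<longleftrightarrow> locally_dominated M f"
| "dominated_Ck M (Suc k) f \<longleftrightarrow>
     locally_dominated M f \<and>
     (\<forall>i. dominated_Ck M k (\<lambda>w. pd i (f w))) \<and> dominated_Ck M k (\<lambda>w. td (f w))"

text \<open>Averages of products are required to exist only for the pairs of factors that occur in the system.\<close>

definition advected :: "quantity set" where
  "advected = {expansion, density} \<union> range vort_vec
     \<union> (\<Union>i j. {shear i j, tidal i j})"

definition moment_factors :: "(quantity \<times> quantity) set" where
  "moment_factors =
     (\<Union>k. \<Union>q\<in>advected. {(vel k, \<lambda>F. pd k (q F))}) \<union>
     {(expansion, expansion), (density, expansion)} \<union>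
     (\<Union>i j. {(expansion, shear i j), (expansion, tidal i j), (density, shear i j)}) \<union>
     (\<Union>i j. {(expansion, vort_vec i), (vort_vec i, vort_vec j)}) \<union>
     (\<Union>i j k. {(shear i j, vort_vec k)}) \<union>
     (\<Union>i j k l. {(shear i j, shear k l), (shear i j, tidal k l), (vorticity i j, tidal k l)})"

definition regular_random_fluid :: "'w measure \<Rightarrow> ('w \<Rightarrow> fluid) \<Rightarrow> bool" where
  "regular_random_fluid M F \<longleftrightarrow>
     (\<forall>w\<in>space M. regular_fluid (F w)) \<and>
     (\<forall>i. dominated_Ck M 3 (\<lambda>w. vel i (F w))) \<and>
     dominated_Ck M 3 (\<lambda>w. potential (F w)) \<and>
     dominated_Ck M 1 (\<lambda>w. density (F w)) \<and>
     (\<forall>i. dominated_Ck M 1 (\<lambda>w. total_acc i (F w))) \<and>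
     (\<forall>(q, r)\<in>moment_factors. \<forall>x t. integrable M (\<lambda>w. q (F w) x t * r (F w) x t))"

end

theory Submission
  imports Defs
begin

text \<open>
  Both averages are expectations of a random fluid observed at a randomly displaced point: in the
  space-time average the fluid is fixed and the displacement is uniform on the averaging cell, in
  the ensemble average there is no displacement.  The law of the displacement does not depend on
  \<open>(x, t)\<close>; this is where the covering hypothesis enters.  By dominated convergence such an
  expectation commutes with the partial derivatives, and the averages of products are left as they
  are, so every averaged equation is the expectation of the corresponding unaveraged one.  In the
  evolution equations the advection correction turns the material derivative of the average into
  $\langle q\rangle_{,t} + \langle u^k q_{,k}\rangle$, which is again linear in the bracket.
\<close>

subsection \<open>Derivatives along coordinate lines\<close>

text \<open>No averaged equation is rederived from the others: even the symmetry of mixed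
  derivatives of the averaged velocity is the bracket of the corresponding unaveraged identity. The
  real obstacle is that \<open>deriv\<close> is total, so exchanging it with an average needs both
  the existence of the derivative along each realization and an integrable bound, at every order
  that occurs. Such bounds pass to sums and constant multiples but not to products. Expansion,
  shear, vorticity and tidal force are linear in derivatives of velocity and potential, so they
  inherit regularity from these two fields; order three is needed because the third integrability
  condition differentiates shear and expansion twice. The total acceleration is quadratic in the
  velocity, and the moments are products, so for a random fluid their bounds are separate
  hypotheses. For one fixed fluid they come for free, because a bounded cell keeps all displaced
  points in a compact ball.\<close>

definition dd :: "(real^3) \<times> real \<Rightarrow> field \<Rightarrow> field" where
  "dd v f = (\<lambda>x t. deriv (\<lambda>s. f (x + s *\<^sub>R fst v) (t + s * snd v)) 0)"

text \<open>Space and time derivatives become one family \<open>dd v\<close> with \<open>v\<close>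
  in this set, so each rule of calculus and each exchange of derivative and average is proved
  once.\<close>

definition coords :: "((real^3) \<times> real) set" where
  "coords = insert (0, 1) (range (\<lambda>i. (axis i 1, 0)))"

definition line_diff :: "(real^3) \<times> real \<Rightarrow> field \<Rightarrow> bool" where
  "line_diff v f \<longleftrightarrow>
     (\<forall>x t. (\<lambda>s. f (x + s *\<^sub>R fst v) (t + s * snd v)) differentiable at 0)"

lemma pd_eq_dd: "pd i = dd (axis i 1, 0)"
  by (simp add: pd_def dd_def fun_eq_iff)

lemma td_eq_dd: "td = dd (0, 1)"
proof (intro ext)
  fix f :: field and x t
  \<comment> \<open>Both derivative predicates hold for the same numbers \<open>D\<close>, so
    \<open>deriv\<close>, which chooses among them, agrees on both sides even where no derivative
    exists.\<close>
  have "(f x has_real_derivative D) (at t) \<longleftrightarrow>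
        ((\<lambda>s. f x (t + s)) has_real_derivative D) (at 0)" for D
    using DERIV_shift[of "f x" D 0 t] by (simp add: add.commute)
  then show "td f x t = dd (0, 1) f x t"
    by (simp add: td_def dd_def deriv_def)
qed

lemma time_differentiable_iff:
  fixes g :: "real \<Rightarrow> real"
  shows "g differentiable at t \<longleftrightarrow> (\<lambda>s. g (t + s)) differentiable at 0"
  using DERIV_shift[of g _ 0 t]
  by (simp add: real_differentiable_def add.commute)

lemma coords_axis [simp]: "(axis i 1, 0) \<in> coords" and coords_time [simp]: "(0, 1) \<in> coords"
  by (auto simp: coords_def)

lemma Ck_Suc:
  "Ck (Suc k) f \<longleftrightarrow> Ck 0 f \<and> (\<forall>v\<in>coords. line_diff v f \<and> Ck k (dd v f))"
  by (auto simp: coords_def line_diff_def pd_eq_dd td_eq_dd time_differentiable_iff[where g="f _"])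

declare Ck.simps(2) [simp del]

text \<open>\<open>line_diff\<close> speaks of parameter 0 only, but for every base point; moving
  the base point along the line gives every other parameter. The mean value estimate under the
  integral needs the derivative on a whole interval.\<close>

lemma line_diff_DERIV:
  assumes "line_diff v f"
  shows "((\<lambda>s. f (x + s *\<^sub>R fst v) (t + s * snd v)) has_real_derivative
           dd v f (x + s *\<^sub>R fst v) (t + s * snd v)) (at s)"
proof -
  let ?x = "x + s *\<^sub>R fst v" and ?t = "t + s * snd v"
  have "((\<lambda>r. f (?x + r *\<^sub>R fst v) (?t + r * snd v)) has_real_derivative dd v f ?x ?t) (at 0)"
    using assms unfolding line_diff_def dd_def by (simp add: DERIV_deriv_iff_real_differentiable)
  then have "((\<lambda>r. f (x + (r + s) *\<^sub>R fst v) (t + (r + s) * snd v)) has_real_derivative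
      dd v f ?x ?t) (at 0)"
    by (simp add: algebra_simps)
  then show ?thesis
    using DERIV_shift[of "\<lambda>s. f (x + s *\<^sub>R fst v) (t + s * snd v)" "dd v f ?x ?t" 0 s] by simp
qed

lemma line_diff_DERIV0:
  assumes "line_diff v f"
  shows "((\<lambda>s. f (x + s *\<^sub>R fst v) (t + s * snd v)) has_real_derivative dd v f x t) (at 0)"
  using line_diff_DERIV[OF assms, of x t 0] by simp

lemma line_diffI:
  assumes "\<And>x t. ((\<lambda>s. f (x + s *\<^sub>R fst v) (t + s * snd v)) has_real_derivative g x t) (at 0)"
  shows "line_diff v f" and "dd v f = g"
  using assms by (auto simp: line_diff_def dd_def real_differentiable_def fun_eq_iff DERIV_imp_deriv)

lemma dd_const: "line_diff v (\<lambda>x t. c)" "dd v (\<lambda>x t. c) = (\<lambda>x t. 0)"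
proof -
  have "((\<lambda>s. c) has_real_derivative 0) (at 0)" by simp
  then show "line_diff v (\<lambda>x t. c)" "dd v (\<lambda>x t. c) = (\<lambda>x t. 0)"
    by (rule line_diffI)+
qed

lemma dd_add:
  assumes "line_diff v f" "line_diff v g"
  shows "line_diff v (\<lambda>x t. f x t + g x t)"
    and "dd v (\<lambda>x t. f x t + g x t) = (\<lambda>x t. dd v f x t + dd v g x t)"
  by (rule line_diffI, rule DERIV_add, rule line_diff_DERIV0[OF assms(1)],
      rule line_diff_DERIV0[OF assms(2)])+

lemma dd_cmult:
  assumes "line_diff v f"
  shows "line_diff v (\<lambda>x t. c * f x t)"
    and "dd v (\<lambda>x t. c * f x t) = (\<lambda>x t. c * dd v f x t)"
  by (rule line_diffI, rule DERIV_cmult, rule line_diff_DERIV0[OF assms])+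

lemma dd_mult:
  assumes "line_diff v f" "line_diff v g"
  shows "line_diff v (\<lambda>x t. f x t * g x t)"
    and "dd v (\<lambda>x t. f x t * g x t) = (\<lambda>x t. dd v f x t * g x t + f x t * dd v g x t)"
proof -
  have "((\<lambda>s. f (x + s *\<^sub>R fst v) (t + s * snd v) * g (x + s *\<^sub>R fst v) (t + s * snd v))
      has_real_derivative dd v f x t * g x t + f x t * dd v g x t) (at 0)" for x t
    using DERIV_mult[OF line_diff_DERIV0[OF assms(1), of x t] line_diff_DERIV0[OF assms(2), of x t]]
    by (simp add: mult.commute)
  from line_diffI[OF this] show "line_diff v (\<lambda>x t. f x t * g x t)"
    and "dd v (\<lambda>x t. f x t * g x t) = (\<lambda>x t. dd v f x t * g x t + f x t * dd v g x t)" .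
qed

lemma Ck_continuous: "Ck n f \<Longrightarrow> Ck 0 f"
  by (cases n) (auto simp: Ck_Suc)

lemma Ck_decrease: "Ck (Suc n) f \<Longrightarrow> Ck n f"
  by (induction n arbitrary: f) (auto simp: Ck_Suc)

lemma Ck_mono: "Ck n f \<Longrightarrow> m \<le> n \<Longrightarrow> Ck m f"
  by (induction n) (auto simp: le_Suc_eq dest: Ck_decrease)

lemma Ck_dd: "Ck (Suc n) f \<Longrightarrow> v \<in> coords \<Longrightarrow> Ck n (dd v f)"
  by (simp add: Ck_Suc)

lemma Ck_pd: "Ck (Suc n) f \<Longrightarrow> Ck n (pd i f)" and Ck_td: "Ck (Suc n) f \<Longrightarrow> Ck n (td f)"
  by (simp_all add: pd_eq_dd td_eq_dd Ck_dd)

lemma Ck_const: "Ck n (\<lambda>x t. c)"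
  by (induction n arbitrary: c) (auto simp: Ck_Suc dd_const)

lemma Ck_add: "Ck n f \<Longrightarrow> Ck n g \<Longrightarrow> Ck n (\<lambda>x t. f x t + g x t)"
  by (induction n arbitrary: f g)
    (auto simp: Ck_Suc dd_add case_prod_unfold intro!: continuous_on_add)

lemma Ck_mult: "Ck n f \<Longrightarrow> Ck n g \<Longrightarrow> Ck n (\<lambda>x t. f x t * g x t)"
proof (induction n arbitrary: f g)
  case 0
  then show ?case by (auto simp: case_prod_unfold intro!: continuous_on_mult)
next
  case (Suc n)
  have c: "Ck 0 (\<lambda>x t. f x t * g x t)"
    using Suc.prems[THEN Ck_continuous] by (auto simp: case_prod_unfold intro!: continuous_on_mult)
  from Suc show ?case
    unfolding Ck_Suc[of n "\<lambda>x t. f x t * g x t"]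
    by (auto simp: c Ck_Suc dd_mult simp del: Ck.simps
        intro!: Ck_add Suc.IH Ck_decrease[OF Suc.prems(1)] Ck_decrease[OF Suc.prems(2)])
qed

lemma Ck_cmult: "Ck n f \<Longrightarrow> Ck n (\<lambda>x t. c * f x t)"
  by (intro Ck_mult Ck_const)

lemma Ck_diff: "Ck n f \<Longrightarrow> Ck n g \<Longrightarrow> Ck n (\<lambda>x t. f x t - g x t)"
  using Ck_add[OF _ Ck_cmult[where c="-1"], of n f g] by simp

lemma Ck_divide: "Ck n f \<Longrightarrow> Ck n (\<lambda>x t. f x t / c)"
  using Ck_cmult[of n f "1/c"] by simp

lemma Ck_sum: "(\<And>i. i \<in> I \<Longrightarrow> Ck n (f i)) \<Longrightarrow> Ck n (\<lambda>x t. \<Sum>i\<in>I. f i x t)"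
  by (induction I rule: infinite_finite_induct) (auto intro: Ck_add Ck_const)

definition translate :: "real^3 \<Rightarrow> real \<Rightarrow> field \<Rightarrow> field" where
  "translate a b f = (\<lambda>x t. f (x + a) (t + b))"

text \<open>Both sides are the same \<open>deriv\<close> expression after reordering sums, so no
  differentiability is required.\<close>

lemma dd_translate: "dd v (translate a b f) = translate a b (dd v f)"
  by (simp add: dd_def translate_def fun_eq_iff algebra_simps)

lemma line_diff_translate: "line_diff v f \<Longrightarrow> line_diff v (translate a b f)"
  unfolding line_diff_def translate_def
proof (intro allI)
  fix x t assume "\<forall>x t. (\<lambda>s. f (x + s *\<^sub>R fst v) (t + s * snd v)) differentiable at 0"
  then have "(\<lambda>s. f ((x + a) + s *\<^sub>R fst v) ((t + b) + s * snd v)) differentiable at 0" by blast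
  then show "(\<lambda>s. f (x + s *\<^sub>R fst v + a) (t + s * snd v + b)) differentiable at 0"
    by (simp add: algebra_simps)
qed

lemma continuous_translate:
  assumes "Ck 0 f"
  shows "Ck 0 (translate a b f)"
proof -
  have c: "continuous_on UNIV (\<lambda>z. f (fst z) (snd z))"
    using assms by (simp add: case_prod_unfold)
  have "continuous_on UNIV (\<lambda>z. f (fst (fst z + a, snd z + b)) (snd (fst z + a, snd z + b)))"
    by (rule continuous_on_compose2[OF c]) (auto intro!: continuous_intros)
  then show ?thesis
    by (simp add: translate_def case_prod_unfold)
qed

lemma Ck_translate: "Ck n f \<Longrightarrow> Ck n (translate a b f)"
proof (induction n arbitrary: f)
  case 0
  then show ?case by (rule continuous_translate)
next
  case (Suc n)
  then show ?case
    unfolding Ck_Suc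
    by (simp add: dd_translate line_diff_translate continuous_translate del: Ck.simps)
qed

subsection \<open>Differentiation under the mean\<close>

definition mean :: "'w measure \<Rightarrow> ('w \<Rightarrow> field) \<Rightarrow> field" where
  "mean M f = (\<lambda>x t. \<integral>w. f w x t \<partial>M)"

text \<open>The two halves feed dominated convergence: smoothness of each realization gives
  pointwise convergence, and \<open>dominated_Ck\<close> gives the integrable bound.\<close>

definition mean_Ck :: "'w measure \<Rightarrow> nat \<Rightarrow> ('w \<Rightarrow> field) \<Rightarrow> bool" where
  "mean_Ck M n f \<longleftrightarrow> (\<forall>w\<in>space M. Ck n (f w)) \<and> dominated_Ck M n f"

lemma dominated_Ck_Suc:
  "dominated_Ck M (Suc k) f \<longleftrightarrow>
     dominated_Ck M 0 f \<and> (\<forall>v\<in>coords. dominated_Ck M k (\<lambda>w. dd v (f w)))"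
  by (auto simp: coords_def pd_eq_dd td_eq_dd)

declare dominated_Ck.simps [simp del]

lemma mean_Ck_Suc:
  "mean_Ck M (Suc n) f \<longleftrightarrow>
     mean_Ck M 0 f \<and> (\<forall>v\<in>coords. (\<forall>w\<in>space M. line_diff v (f w)) \<and> mean_Ck M n (\<lambda>w. dd v (f w)))"
  unfolding mean_Ck_def Ck_Suc dominated_Ck_Suc by blast

lemma locally_dominated_cong:
  assumes "\<And>w. w \<in> space M \<Longrightarrow> f w = g w"
  shows "locally_dominated M f \<longleftrightarrow> locally_dominated M g"
  unfolding locally_dominated_def using assms
  by (simp cong: measurable_cong)

text \<open>Realizations outside \<open>space M\<close> need not be differentiable, so rules such as
  \<open>dd_add\<close> rewrite the family only on \<open>space M\<close>; this lemma lets that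
  suffice.\<close>

lemma mean_Ck_cong:
  assumes "\<And>w. w \<in> space M \<Longrightarrow> f w = g w"
  shows "mean_Ck M n f \<longleftrightarrow> mean_Ck M n g"
  using assms
proof (induction n arbitrary: f g)
  case 0
  then show ?case
    using locally_dominated_cong[of M f g] by (simp add: mean_Ck_def dominated_Ck.simps)
next
  case (Suc n)
  have "mean_Ck M 0 f \<longleftrightarrow> mean_Ck M 0 g"
    using Suc.prems locally_dominated_cong[of M f g] by (simp add: mean_Ck_def dominated_Ck.simps)
  moreover have "mean_Ck M n (\<lambda>w. dd v (f w)) \<longleftrightarrow> mean_Ck M n (\<lambda>w. dd v (g w))" for v
    using Suc by metis
  ultimately show ?case
    unfolding mean_Ck_Suc using Suc.prems by simp
qed

lemma mean_Ck_continuous: "mean_Ck M n f \<Longrightarrow> mean_Ck M 0 f"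
  by (cases n) (auto simp: mean_Ck_Suc)

lemma mean_Ck_decrease: "mean_Ck M (Suc n) f \<Longrightarrow> mean_Ck M n f"
  by (induction n arbitrary: f) (auto simp: mean_Ck_Suc)

lemma locally_dominatedE:
  assumes "locally_dominated M f"
  obtains r Z where "r > 0" "integrable M Z"
    and "\<And>w y s. w \<in> space M \<Longrightarrow> dist y x < r \<Longrightarrow> dist s t < r \<Longrightarrow> \<bar>f w y s\<bar> \<le> Z w"
  using assms unfolding locally_dominated_def by meson

lemma locally_dominated_measurable:
  "locally_dominated M f \<Longrightarrow> (\<lambda>w. f w x t) \<in> borel_measurable M"
  by (simp add: locally_dominated_def)

lemma mean_Ck_integrable:
  assumes "mean_Ck M n f"
  shows "integrable M (\<lambda>w. f w x t)"
proof -
  from mean_Ck_continuous[OF assms] have ld: "locally_dominated M f"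
    by (simp add: mean_Ck_def dominated_Ck.simps)
  obtain r Z where r: "r > 0" and Z: "integrable M Z"
    and b: "\<And>w y s. w \<in> space M \<Longrightarrow> dist y x < r \<Longrightarrow> dist s t < r \<Longrightarrow> \<bar>f w y s\<bar> \<le> Z w"
    using locally_dominatedE[OF ld, of x t] by metis
  show ?thesis
    by (rule Bochner_Integration.integrable_bound[OF Z locally_dominated_measurable[OF ld]])
      (use r b[of _ x t] in \<open>auto intro!: AE_I2 intro: order_trans[OF _ abs_ge_self]\<close>)
qed

lemma locally_dominated_add:
  assumes "locally_dominated M f" "locally_dominated M g"
  shows "locally_dominated M (\<lambda>w x t. f w x t + g w x t)"
  unfolding locally_dominated_def
proof (intro allI conjI)
  fix x t
  show "(\<lambda>w. f w x t + g w x t) \<in> borel_measurable M"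
    using assms unfolding locally_dominated_def by (auto intro: borel_measurable_add)
  obtain r Z where "r > 0" "integrable M Z"
    and b: "\<And>w y s. w \<in> space M \<Longrightarrow> dist y x < r \<Longrightarrow> dist s t < r \<Longrightarrow> \<bar>f w y s\<bar> \<le> Z w"
    using locally_dominatedE[OF assms(1), of x t] by metis
  moreover obtain r' Z' where "r' > 0" "integrable M Z'"
    and b': "\<And>w y s. w \<in> space M \<Longrightarrow> dist y x < r' \<Longrightarrow> dist s t < r' \<Longrightarrow> \<bar>g w y s\<bar> \<le> Z' w"
    using locally_dominatedE[OF assms(2), of x t] by metis
  ultimately show "\<exists>r>0. \<exists>Z. integrable M Z \<and>
      (\<forall>w\<in>space M. \<forall>y s. dist y x < r \<longrightarrow> dist s t < r \<longrightarrow> \<bar>f w y s + g w y s\<bar> \<le> Z w)"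
    by (intro exI[of _ "min r r'"] conjI exI[of _ "\<lambda>w. Z w + Z' w"])
      (auto intro!: order_trans[OF abs_triangle_ineq] add_mono)
qed

lemma locally_dominated_cmult:
  assumes "locally_dominated M f"
  shows "locally_dominated M (\<lambda>w x t. c * f w x t)"
  unfolding locally_dominated_def
proof (intro allI conjI)
  fix x t
  show "(\<lambda>w. c * f w x t) \<in> borel_measurable M"
    using assms unfolding locally_dominated_def by (auto intro: borel_measurable_times)
  obtain r Z where "r > 0" "integrable M Z"
    and b: "\<And>w y s. w \<in> space M \<Longrightarrow> dist y x < r \<Longrightarrow> dist s t < r \<Longrightarrow> \<bar>f w y s\<bar> \<le> Z w"
    using locally_dominatedE[OF assms, of x t] by metis
  then show "\<exists>r>0. \<exists>Z. integrable M Z \<and>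
      (\<forall>w\<in>space M. \<forall>y s. dist y x < r \<longrightarrow> dist s t < r \<longrightarrow> \<bar>c * f w y s\<bar> \<le> Z w)"
    by (intro exI[of _ r] conjI exI[of _ "\<lambda>w. \<bar>c\<bar> * Z w"])
      (auto simp: abs_mult intro!: mult_left_mono)
qed

lemma mean_Ck_add:
  assumes "mean_Ck M n f" "mean_Ck M n g"
  shows "mean_Ck M n (\<lambda>w x t. f w x t + g w x t)"
  using assms
proof (induction n arbitrary: f g)
  case 0
  then show ?case
    using Ck_add[where n=0]
    by (auto simp: mean_Ck_def dominated_Ck.simps locally_dominated_add simp del: Ck.simps)
next
  case (Suc n)
  have "mean_Ck M 0 (\<lambda>w x t. f w x t + g w x t)"
    using Suc.prems[THEN mean_Ck_continuous] Ck_add[where n=0]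
    by (auto simp: mean_Ck_def dominated_Ck.simps locally_dominated_add simp del: Ck.simps)
  moreover {
    fix v assume v: "v \<in> coords"
    have "mean_Ck M n (\<lambda>w. dd v (\<lambda>x t. f w x t + g w x t)) \<longleftrightarrow>
          mean_Ck M n (\<lambda>w x t. dd v (f w) x t + dd v (g w) x t)"
      by (rule mean_Ck_cong) (use Suc.prems v in \<open>auto simp: mean_Ck_Suc dd_add\<close>)
    then have "mean_Ck M n (\<lambda>w. dd v (\<lambda>x t. f w x t + g w x t))"
      using Suc v by (simp add: mean_Ck_Suc) }
  ultimately show ?case
    using Suc.prems unfolding mean_Ck_Suc by (auto intro: dd_add)
qed

lemma mean_Ck_cmult:
  assumes "mean_Ck M n f"
  shows "mean_Ck M n (\<lambda>w x t. c * f w x t)"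
  using assms
proof (induction n arbitrary: f)
  case 0
  then show ?case
    using Ck_cmult[where n=0]
    by (auto simp: mean_Ck_def dominated_Ck.simps locally_dominated_cmult simp del: Ck.simps)
next
  case (Suc n)
  have "mean_Ck M 0 (\<lambda>w x t. c * f w x t)"
    using Suc.prems[THEN mean_Ck_continuous] Ck_cmult[where n=0]
    by (auto simp: mean_Ck_def dominated_Ck.simps locally_dominated_cmult simp del: Ck.simps)
  moreover {
    fix v assume v: "v \<in> coords"
    have "mean_Ck M n (\<lambda>w. dd v (\<lambda>x t. c * f w x t)) \<longleftrightarrow>
          mean_Ck M n (\<lambda>w x t. c * dd v (f w) x t)"
      by (rule mean_Ck_cong) (use Suc.prems v in \<open>auto simp: mean_Ck_Suc dd_cmult\<close>)
    then have "mean_Ck M n (\<lambda>w. dd v (\<lambda>x t. c * f w x t))"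
      using Suc v by (simp add: mean_Ck_Suc) }
  ultimately show ?case
    using Suc.prems unfolding mean_Ck_Suc by (auto intro: dd_cmult)
qed

lemma mean_continuous:
  assumes "mean_Ck M 0 f"
  shows "Ck 0 (mean M f)"
proof -
  have "isCont (\<lambda>z. mean M f (fst z) (snd z)) z" for z
  proof (rule continuous_at_sequentiallyI)
    fix X :: "nat \<Rightarrow> (real^3) \<times> real" assume X: "X \<longlonglongrightarrow> z"
    have ld: "locally_dominated M f" and cont: "\<And>w. w \<in> space M \<Longrightarrow> Ck 0 (f w)"
      using assms by (auto simp: mean_Ck_def dominated_Ck.simps)
    have m: "(\<lambda>w. f w x t) \<in> borel_measurable M" for x t
      using ld by (simp add: locally_dominated_def)
    obtain r Z where r: "r > 0" and Z: "integrable M Z"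
      and b: "\<And>w y s. w \<in> space M \<Longrightarrow> dist y (fst z) < r \<Longrightarrow> dist s (snd z) < r \<Longrightarrow> \<bar>f w y s\<bar> \<le> Z w"
      using locally_dominatedE[OF ld, of "fst z" "snd z"] by metis
    \<comment> \<open>The bound \<open>Z\<close> holds only near \<open>z\<close>, so the
      convergence theorem is applied to the tail of \<open>X\<close> from \<open>N\<close> on, and
      the shift is removed at the end.\<close>
    obtain N where N: "\<And>n. n \<ge> N \<Longrightarrow> dist (X n) z < r"
      using metric_LIMSEQ_D[OF X r] by auto
    have "(\<lambda>n. \<integral>w. f w (fst (X (n + N))) (snd (X (n + N))) \<partial>M) \<longlonglongrightarrow> (\<integral>w. f w (fst z) (snd z) \<partial>M)"
    proof (rule integral_dominated_convergence[where w=Z])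
      show "AE w in M. (\<lambda>n. f w (fst (X (n + N))) (snd (X (n + N)))) \<longlonglongrightarrow> f w (fst z) (snd z)"
      proof (rule AE_I2)
        fix w assume "w \<in> space M"
        then have "isCont (\<lambda>z. f w (fst z) (snd z)) z"
          using cont[of w] by (simp add: case_prod_unfold continuous_on_eq_continuous_at del: split_paired_All)
        from isCont_tendsto_compose[OF this LIMSEQ_ignore_initial_segment[OF X, of N]]
        show "(\<lambda>n. f w (fst (X (n + N))) (snd (X (n + N)))) \<longlonglongrightarrow> f w (fst z) (snd z)" .
      qed
      show "AE w in M. norm (f w (fst (X (n + N))) (snd (X (n + N)))) \<le> Z w" for n
      proof (rule AE_I2)
        fix w assume "w \<in> space M"
        with b[of w] N[of "n + N"] dist_fst_le[of "X (n + N)" z] dist_snd_le[of "X (n + N)" z]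
        show "norm (f w (fst (X (n + N))) (snd (X (n + N)))) \<le> Z w" by fastforce
      qed
    qed (use m Z in auto)
    then show "(\<lambda>n. mean M f (fst (X n)) (snd (X n))) \<longlonglongrightarrow> mean M f (fst z) (snd z)"
      unfolding mean_def by (rule LIMSEQ_offset)
  qed
  then show ?thesis
    by (simp add: case_prod_unfold continuous_on_eq_continuous_at)
qed

text \<open>The difference quotients converge for each realization, and the mean value inequality
  bounds them by the function \<open>Z\<close> that dominates the derivative; dominated convergence
  then moves the limit inside. Domination of \<open>f\<close> itself makes the means in the quotient
  meaningful.\<close>

lemma dd_mean:
  assumes f: "mean_Ck M 0 f" and ld: "\<And>w. w \<in> space M \<Longrightarrow> line_diff v (f w)"
    and f': "mean_Ck M 0 (\<lambda>w. dd v (f w))"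
  shows "line_diff v (mean M f)" and "dd v (mean M f) = mean M (\<lambda>w. dd v (f w))"
proof -
  have "((\<lambda>s. mean M f (x + s *\<^sub>R fst v) (t + s * snd v)) has_real_derivative
          mean M (\<lambda>w. dd v (f w)) x t) (at 0)" for x t
    unfolding has_field_derivative_iff tendsto_at_iff_sequentially o_def
  proof (intro allI impI)
    fix X :: "nat \<Rightarrow> real" assume X0: "\<forall>i. X i \<in> UNIV - {0}" and X: "X \<longlonglongrightarrow> 0"
    let ?L = "\<lambda>w s. f w (x + s *\<^sub>R fst v) (t + s * snd v)"
    have int: "integrable M (\<lambda>w. f w y s)" for y s
      using f by (rule mean_Ck_integrable)
    have m': "(\<lambda>w. dd v (f w) x t) \<in> borel_measurable M"
      using mean_Ck_integrable[OF f'] by blast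
    obtain r Z where r: "r > 0" and Z: "integrable M Z"
      and b: "\<And>w y s. w \<in> space M \<Longrightarrow> dist y x < r \<Longrightarrow> dist s t < r \<Longrightarrow> \<bar>dd v (f w) y s\<bar> \<le> Z w"
      using f' locally_dominatedE[of M "\<lambda>w. dd v (f w)" x t]
      unfolding mean_Ck_def dominated_Ck.simps by metis
    \<comment> \<open>A step of size below \<open>e\<close> along \<open>v\<close> moves
      \<open>x\<close> and \<open>t\<close> by less than \<open>r\<close> each; the summand 1 keeps
      the denominator positive whatever \<open>v\<close> is.\<close>
    define e where "e = r / (1 + norm (fst v) + \<bar>snd v\<bar>)"
    have pos: "0 < 1 + norm (fst v) + \<bar>snd v\<bar>"
      by (smt (verit) norm_ge_zero)
    have e: "e > 0"
      using r pos by (simp add: e_def)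
    have near: "dist (x + s *\<^sub>R fst v) x < r \<and> dist (t + s * snd v) t < r" if "\<bar>s\<bar> < e" for s
    proof -
      have "\<bar>s\<bar> * (1 + norm (fst v) + \<bar>snd v\<bar>) < r"
        using that pos by (simp add: e_def pos_less_divide_eq)
      moreover have "\<bar>s\<bar> * norm (fst v) \<le> \<bar>s\<bar> * (1 + norm (fst v) + \<bar>snd v\<bar>)"
        and "\<bar>s\<bar> * \<bar>snd v\<bar> \<le> \<bar>s\<bar> * (1 + norm (fst v) + \<bar>snd v\<bar>)"
        by (intro mult_left_mono; simp)+
      ultimately show ?thesis
        by (simp add: dist_norm abs_mult)
    qed
    \<comment> \<open>The whole segment between parameters 0 and \<open>s\<close> stays in the
      region where \<open>Z\<close> dominates the derivative, so the mean value inequality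
      applies.\<close>
    have quot: "\<bar>(?L w s - ?L w 0) / s\<bar> \<le> Z w" if w: "w \<in> space M" and s: "\<bar>s\<bar> < e" "s \<noteq> 0" for w s
    proof -
      have "norm (?L w s - ?L w 0) \<le> Z w * norm (s - 0)"
      proof (rule field_differentiable_bound[where S="{-e<..<e}"])
        show "(?L w has_field_derivative dd v (f w) (x + u *\<^sub>R fst v) (t + u * snd v))
            (at u within {-e<..<e})" for u
          using line_diff_DERIV[OF ld[OF w]] by (rule has_field_derivative_at_within)
        show "norm (dd v (f w) (x + u *\<^sub>R fst v) (t + u * snd v)) \<le> Z w" if "u \<in> {-e<..<e}" for u
          using b[OF w] near[of u] that by auto
      qed (use s e in auto)
      then show ?thesis
        using s by (simp add: field_simps)
    qed
    obtain N where N: "\<And>n. n \<ge> N \<Longrightarrow> \<bar>X n\<bar> < e"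
      using metric_LIMSEQ_D[OF X e] by (auto simp: dist_real_def)
    have "(\<lambda>n. \<integral>w. (?L w (X (n + N)) - ?L w 0) / X (n + N) \<partial>M) \<longlonglongrightarrow> (\<integral>w. dd v (f w) x t \<partial>M)"
    proof (rule integral_dominated_convergence[where w=Z])
      show "AE w in M. (\<lambda>n. (?L w (X (n + N)) - ?L w 0) / X (n + N)) \<longlonglongrightarrow> dd v (f w) x t"
      proof (rule AE_I2)
        fix w assume "w \<in> space M"
        from line_diff_DERIV0[OF ld[OF this], of x t, unfolded has_field_derivative_iff
            tendsto_at_iff_sequentially o_def, rule_format, of X] X0 X
        have "(\<lambda>n. (?L w (X n) - ?L w 0) / (X n - 0)) \<longlonglongrightarrow> dd v (f w) x t" by blast
        from LIMSEQ_ignore_initial_segment[OF this, of N]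
        show "(\<lambda>n. (?L w (X (n + N)) - ?L w 0) / X (n + N)) \<longlonglongrightarrow> dd v (f w) x t" by simp
      qed
      show "AE w in M. norm ((?L w (X (n + N)) - ?L w 0) / X (n + N)) \<le> Z w" for n
        using quot[of _ "X (n + N)"] N[of "n + N"] X0 by (auto intro!: AE_I2)
      show "(\<lambda>w. (?L w (X (n + N)) - ?L w 0) / X (n + N)) \<in> borel_measurable M" for n
        using int[THEN borel_measurable_integrable] by measurable
    qed (use m' Z in auto)
    moreover have "(\<integral>w. (?L w s - ?L w 0) / s \<partial>M) =
        (mean M f (x + s *\<^sub>R fst v) (t + s * snd v) - mean M f x t) / s" for s
      unfolding mean_def by (simp add: Bochner_Integration.integral_diff[OF int int])
    ultimately have "(\<lambda>n. (mean M f (x + X (n + N) *\<^sub>R fst v) (t + X (n + N) * snd v) - mean M f x t) / X (n + N))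
        \<longlonglongrightarrow> mean M (\<lambda>w. dd v (f w)) x t"
      by (simp add: mean_def Bochner_Integration.integral_diff[OF int int])
    from LIMSEQ_offset[OF this]
    show "(\<lambda>n. (mean M f (x + X n *\<^sub>R fst v) (t + X n * snd v)
         - mean M f (x + 0 *\<^sub>R fst v) (t + 0 * snd v)) / (X n - 0))
        \<longlonglongrightarrow> mean M (\<lambda>w. dd v (f w)) x t"
      by simp
  qed
  from line_diffI[OF this] show "line_diff v (mean M f)"
    and "dd v (mean M f) = mean M (\<lambda>w. dd v (f w))" .
qed

lemma mean_Ck_dd: "mean_Ck M (Suc n) f \<Longrightarrow> v \<in> coords \<Longrightarrow> mean_Ck M n (\<lambda>w. dd v (f w))"
  by (simp add: mean_Ck_Suc)

lemma dd_mean_eq: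
  assumes "mean_Ck M (Suc n) f" "v \<in> coords"
  shows "line_diff v (mean M f)" and "dd v (mean M f) = mean M (\<lambda>w. dd v (f w))"
  using assms mean_Ck_continuous by (auto intro!: dd_mean simp: mean_Ck_Suc)

lemma Ck_mean: "mean_Ck M n f \<Longrightarrow> Ck n (mean M f)"
proof (induction n arbitrary: f)
  case 0
  then show ?case by (rule mean_continuous)
next
  case (Suc n)
  then show ?case
    unfolding Ck_Suc using dd_mean_eq[OF Suc.prems] mean_continuous[OF mean_Ck_continuous[OF Suc.prems]]
    by (simp add: mean_Ck_dd del: Ck.simps)
qed

subsection \<open>Averaging the equations\<close>

text \<open>Without brackets the advection correction is a difference of equal terms. This brings
  the unaveraged evolution equations to the form whose bracket is taken.\<close>

lemma mat_adv_unaveraged: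
  "mat_deriv (\<lambda>q. q F) q x t + adv_corr (\<lambda>q. q F) q x t
     = td (q F) x t + (\<Sum>k\<in>UNIV. vel k F x t * pd k (q F) x t)"
  by (simp add: mat_deriv_def adv_corr_def)

text \<open>The chains of \<open>UnI1\<close> and \<open>UnI2\<close> trace the position of each
  pair in the left-nested union defining \<open>moment_factors\<close>.\<close>

lemma moment_factors_products:
  "(expansion, expansion) \<in> moment_factors" "(density, expansion) \<in> moment_factors"
  "(expansion, shear i j) \<in> moment_factors" "(expansion, tidal i j) \<in> moment_factors"
  "(density, shear i j) \<in> moment_factors"
  "(expansion, vort_vec i) \<in> moment_factors" "(vort_vec i, vort_vec j) \<in> moment_factors"
  "(shear i j, vort_vec k) \<in> moment_factors"
  "(shear i j, shear k l) \<in> moment_factors" "(shear i j, tidal k l) \<in> moment_factors"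
  "(vorticity i j, tidal k l) \<in> moment_factors"
proof -
  show "(expansion, expansion) \<in> moment_factors" "(density, expansion) \<in> moment_factors"
    unfolding moment_factors_def
    by (rule UnI1, rule UnI1, rule UnI1, rule UnI1, rule UnI2, rule insertI1 insertI2[OF insertI1])+
  show "(expansion, shear i j) \<in> moment_factors" "(expansion, tidal i j) \<in> moment_factors"
    "(density, shear i j) \<in> moment_factors"
    unfolding moment_factors_def
    by (rule UnI1, rule UnI1, rule UnI1, rule UnI2, rule UN_I[OF UNIV_I], rule UN_I[OF UNIV_I],
        (rule insertI1 | rule insertI2)+)+
  show "(expansion, vort_vec i) \<in> moment_factors" "(vort_vec i, vort_vec j) \<in> moment_factors"
    unfolding moment_factors_def
    by (rule UnI1, rule UnI1, rule UnI2, rule UN_I[OF UNIV_I], rule UN_I[OF UNIV_I],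
        (rule insertI1 | rule insertI2)+)+
  show "(shear i j, vort_vec k) \<in> moment_factors"
    unfolding moment_factors_def by (rule UnI1, rule UnI2) blast
  show "(shear i j, shear k l) \<in> moment_factors" "(shear i j, tidal k l) \<in> moment_factors"
    "(vorticity i j, tidal k l) \<in> moment_factors"
    unfolding moment_factors_def
    by (rule UnI2, rule UN_I[OF UNIV_I], rule UN_I[OF UNIV_I], rule UN_I[OF UNIV_I],
        rule UN_I[OF UNIV_I], (rule insertI1 | rule insertI2)+)+
qed

text \<open>
  \<open>w\<close> selects the fluid \<open>R w\<close> and the displacement \<open>(a w, b w)\<close> at which it is observed: the
  ensemble average has \<open>a = b = 0\<close>, and the space-time average has a constant \<open>R\<close>.
  \<open>B_mean\<close> is confined to integrable quantities because an iterated integral that is not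
  absolutely convergent need not be a mean; for the others, such as the equation of state with an
  arbitrary \<open>\<rho>\<^sub>p\<close>, \<open>B_cong\<close> suffices.
\<close>

locale averaging =
  fixes M :: "'w measure" and R :: "'w \<Rightarrow> fluid" and a :: "'w \<Rightarrow> real^3" and b :: "'w \<Rightarrow> real"
    and B :: bracket
  assumes prob: "prob_space M"
    and B_mean: "\<And>q. (\<And>x t. integrable M (\<lambda>w. translate (a w) (b w) (q (R w)) x t)) \<Longrightarrow>
      B q = mean M (\<lambda>w. translate (a w) (b w) (q (R w)))"
    and B_cong: "\<And>q r. (\<And>w. w \<in> space M \<Longrightarrow> q (R w) = r (R w)) \<Longrightarrow> B q = B r"
    and vel_Ck: "\<And>i. mean_Ck M 3 (\<lambda>w. translate (a w) (b w) (vel i (R w)))"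
    and potential_Ck: "mean_Ck M 3 (\<lambda>w. translate (a w) (b w) (potential (R w)))"
    and density_Ck: "mean_Ck M 1 (\<lambda>w. translate (a w) (b w) (density (R w)))"
    and total_acc_Ck: "\<And>i. mean_Ck M 1 (\<lambda>w. translate (a w) (b w) (total_acc i (R w)))"
    and moments: "\<And>q r x t. (q, r) \<in> moment_factors \<Longrightarrow>
      integrable M (\<lambda>w. translate (a w) (b w) (\<lambda>x t. q (R w) x t * r (R w) x t) x t)"
begin

text \<open>The quantities on which \<open>B_mean\<close> turns the bracket into an integral, and
  hence into a linear operation.\<close>

definition admissible :: "quantity \<Rightarrow> bool" where
  "admissible q \<longleftrightarrow> (\<forall>x t. integrable M (\<lambda>w. translate (a w) (b w) (q (R w)) x t))"

text \<open>The quantities whose bracket may be differentiated \<open>n\<close> times under the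
  integral.\<close>

definition bracket_Ck :: "nat \<Rightarrow> quantity \<Rightarrow> bool" where
  "bracket_Ck n q \<longleftrightarrow> mean_Ck M n (\<lambda>w. translate (a w) (b w) (q (R w)))"

section \<open>Linearity of the bracket on integrable quantities\<close>

lemma B_eq: "admissible q \<Longrightarrow> B q x t = (\<integral>w. translate (a w) (b w) (q (R w)) x t \<partial>M)"
  using B_mean[of q] by (simp add: admissible_def mean_def)

lemma admissible_add: "admissible q \<Longrightarrow> admissible r \<Longrightarrow> admissible (\<lambda>F x t. q F x t + r F x t)"
  by (simp add: admissible_def translate_def)

lemma admissible_diff: "admissible q \<Longrightarrow> admissible r \<Longrightarrow> admissible (\<lambda>F x t. q F x t - r F x t)"
  by (simp add: admissible_def translate_def)

lemma admissible_minus: "admissible q \<Longrightarrow> admissible (\<lambda>F x t. - q F x t)"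
  by (simp add: admissible_def translate_def)

lemma admissible_cmult: "admissible q \<Longrightarrow> admissible (\<lambda>F x t. c * q F x t)"
  by (simp add: admissible_def translate_def)

lemma admissible_divide: "admissible q \<Longrightarrow> admissible (\<lambda>F x t. q F x t / c)"
  by (simp add: admissible_def translate_def)

lemma admissible_const: "admissible (\<lambda>F x t. c)"
proof -
  interpret prob_space M by (rule prob)
  show ?thesis by (simp add: admissible_def translate_def)
qed

lemma admissible_sum: "(\<And>i. admissible (q i)) \<Longrightarrow> admissible (\<lambda>F x t. \<Sum>i\<in>A. q i F x t)"
  by (simp add: admissible_def translate_def)

lemma B_add: "admissible q \<Longrightarrow> admissible r \<Longrightarrow> B (\<lambda>F x t. q F x t + r F x t) x t = B q x t + B r x t"
  using admissible_add[of q r] by (simp add: B_eq) (simp add: admissible_def translate_def)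

lemma B_diff: "admissible q \<Longrightarrow> admissible r \<Longrightarrow> B (\<lambda>F x t. q F x t - r F x t) x t = B q x t - B r x t"
  using admissible_diff[of q r] by (simp add: B_eq) (simp add: admissible_def translate_def)

lemma B_minus: "admissible q \<Longrightarrow> B (\<lambda>F x t. - q F x t) x t = - B q x t"
  using admissible_minus[of q] by (simp add: B_eq) (simp add: admissible_def translate_def)

lemma B_cmult: "admissible q \<Longrightarrow> B (\<lambda>F x t. c * q F x t) x t = c * B q x t"
  using admissible_cmult[of q c] by (simp add: B_eq) (simp add: admissible_def translate_def)

lemma B_divide: "admissible q \<Longrightarrow> B (\<lambda>F x t. q F x t / c) x t = B q x t / c"
  using admissible_divide[of q c] by (simp add: B_eq) (simp add: admissible_def translate_def)

text \<open>Total mass one is what leaves \<Lambda> unchanged in the averaged Raychaudhuri and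
  Poisson equations.\<close>

lemma B_const: "B (\<lambda>F x t. c) x t = c"
proof -
  interpret prob_space M by (rule prob)
  show ?thesis by (simp add: B_eq[OF admissible_const] translate_def prob_space)
qed

lemma B_sum: "(\<And>i. admissible (q i)) \<Longrightarrow> B (\<lambda>F x t. \<Sum>i\<in>A. q i F x t) x t = (\<Sum>i\<in>A. B (q i) x t)"
  using admissible_sum[of q A]
  by (simp add: B_eq) (simp add: admissible_def translate_def Bochner_Integration.integral_sum)

lemma admissible_cmult_right: "admissible q \<Longrightarrow> admissible (\<lambda>F x t. q F x t * c)"
  using admissible_cmult[of q c] by (simp add: mult.commute)

lemma B_cmult_right: "admissible q \<Longrightarrow> B (\<lambda>F x t. q F x t * c) x t = B q x t * c"
  using B_cmult[of q c x t] by (simp add: mult.commute)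

text \<open>It rests on \<open>B_cong\<close> alone, so an unaveraged equation passes to brackets
  before any integrability is known.\<close>

lemma B_eqI:
  assumes "\<And>w x t. w \<in> space M \<Longrightarrow> q (R w) x t = r (R w) x t"
  shows "B q x t = B r x t"
  using B_cong[of q r] assms by (simp add: fun_eq_iff)

section \<open>Commutation of the bracket with partial derivatives\<close>

lemma bracket_Ck_admissible: "bracket_Ck n q \<Longrightarrow> admissible q"
  by (auto simp: bracket_Ck_def admissible_def intro: mean_Ck_integrable)

lemma reg_Ck: "bracket_Ck n q \<Longrightarrow> Ck n (B q)"
  using bracket_Ck_admissible[of n q]
  by (simp add: admissible_def B_mean) (simp add: bracket_Ck_def Ck_mean)

lemma bracket_Ck_decrease: "bracket_Ck (Suc n) q \<Longrightarrow> bracket_Ck n q"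
  by (simp add: bracket_Ck_def mean_Ck_decrease)

lemma bracket_Ck_dd: "bracket_Ck (Suc n) q \<Longrightarrow> v \<in> coords \<Longrightarrow> bracket_Ck n (\<lambda>F. dd v (q F))"
  using mean_Ck_dd[of M n "\<lambda>w. translate (a w) (b w) (q (R w))" v]
  by (simp add: bracket_Ck_def dd_translate)

text \<open>\<open>dd_mean_eq\<close> moves the derivative under the mean, and
  \<open>dd_translate\<close> then moves it past the displacement, which does not depend on the
  point of evaluation.\<close>

lemma B_dd:
  assumes "bracket_Ck (Suc n) q" "v \<in> coords"
  shows "dd v (B q) = B (\<lambda>F. dd v (q F))"
proof -
  have "dd v (B q) = dd v (mean M (\<lambda>w. translate (a w) (b w) (q (R w))))"
    using bracket_Ck_admissible[OF assms(1)] by (simp add: B_mean admissible_def)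
  also have "\<dots> = mean M (\<lambda>w. translate (a w) (b w) (dd v (q (R w))))"
    using dd_mean_eq(2)[of M n "\<lambda>w. translate (a w) (b w) (q (R w))" v] assms
    by (simp add: bracket_Ck_def dd_translate)
  also have "\<dots> = B (\<lambda>F. dd v (q F))"
    using bracket_Ck_admissible[OF bracket_Ck_dd[OF assms]] by (simp add: B_mean admissible_def)
  finally show ?thesis .
qed

lemma bracket_Ck_pd: "bracket_Ck (Suc n) q \<Longrightarrow> bracket_Ck n (\<lambda>F. pd i (q F))"
  and bracket_Ck_td: "bracket_Ck (Suc n) q \<Longrightarrow> bracket_Ck n (\<lambda>F. td (q F))"
  by (simp_all add: pd_eq_dd td_eq_dd bracket_Ck_dd)

lemma B_pd: "bracket_Ck 1 q \<Longrightarrow> pd i (B q) = B (\<lambda>F. pd i (q F))"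
  and B_td: "bracket_Ck 1 q \<Longrightarrow> td (B q) = B (\<lambda>F. td (q F))"
  using B_dd[of 0 q] by (simp_all add: pd_eq_dd td_eq_dd)

lemma bracket_Ck_add: "bracket_Ck n q \<Longrightarrow> bracket_Ck n r \<Longrightarrow> bracket_Ck n (\<lambda>F x t. q F x t + r F x t)"
  by (simp add: bracket_Ck_def translate_def mean_Ck_add)

lemma bracket_Ck_cmult: "bracket_Ck n q \<Longrightarrow> bracket_Ck n (\<lambda>F x t. c * q F x t)"
  by (simp add: bracket_Ck_def translate_def mean_Ck_cmult)

lemma bracket_Ck_diff: "bracket_Ck n q \<Longrightarrow> bracket_Ck n r \<Longrightarrow> bracket_Ck n (\<lambda>F x t. q F x t - r F x t)"
  using bracket_Ck_add[OF _ bracket_Ck_cmult[where c="-1"], of n q r] by simp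

lemma bracket_Ck_divide: "bracket_Ck n q \<Longrightarrow> bracket_Ck n (\<lambda>F x t. q F x t / c)"
  using bracket_Ck_cmult[of n q "1/c"] by simp

lemma bracket_Ck_sum:
  fixes q :: "'i::finite \<Rightarrow> quantity"
  assumes "\<And>i. bracket_Ck n (q i)"
  shows "bracket_Ck n (\<lambda>F x t. \<Sum>i\<in>UNIV. q i F x t)"
proof -
  \<comment> \<open>Excluding the empty sum spares a regularity statement about the zero field: the
    induction effectively starts at singletons, and \<open>UNIV\<close> is nonempty.\<close>
  have "A \<noteq> {} \<Longrightarrow> bracket_Ck n (\<lambda>F x t. \<Sum>i\<in>A. q i F x t)" for A :: "'i set"
    using finite[of A]
  proof (induction A rule: finite_induct)
    case (insert i A)
    then show ?case by (cases "A = {}") (simp_all add: assms bracket_Ck_add)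
  qed simp
  then show ?thesis by blast
qed

lemma mat_adv:
  "bracket_Ck 1 q \<Longrightarrow> mat_deriv B q x t + adv_corr B q x t
     = B (\<lambda>F. td (q F)) x t + B (\<lambda>F x t. \<Sum>k\<in>UNIV. vel k F x t * pd k (q F) x t) x t"
  by (simp add: mat_deriv_def adv_corr_def B_td)

section \<open>Regularity and integrability of the quantities in the system\<close>

lemma bracket_Ck3: "bracket_Ck 3 (vel i)" "bracket_Ck 3 potential"
  using vel_Ck potential_Ck by (simp_all add: bracket_Ck_def)

lemma bracket_Ck2_basic: "bracket_Ck 2 (vel i)" "bracket_Ck 2 potential"
  "bracket_Ck 2 (\<lambda>F. pd j (vel i F))" "bracket_Ck 2 (\<lambda>F. pd j (potential F))"
  using bracket_Ck3 bracket_Ck_decrease[of 2] bracket_Ck_pd[of 2] by simp_all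

lemma bracket_Ck2: "bracket_Ck 2 (vel i)" "bracket_Ck 2 potential" "bracket_Ck 2 expansion" "bracket_Ck 2 (shear i j)"
  "bracket_Ck 2 (vorticity i j)" "bracket_Ck 2 (vort_vec i)" "bracket_Ck 2 (grav i)"
proof -
  show e: "bracket_Ck 2 expansion"
    unfolding expansion_def[abs_def] by (intro bracket_Ck_sum bracket_Ck2_basic)
  show "bracket_Ck 2 (shear i j)"
    unfolding shear_def[abs_def]
    by (intro bracket_Ck_diff bracket_Ck_divide bracket_Ck_add bracket_Ck_cmult
        bracket_Ck2_basic e)
  have v: "bracket_Ck 2 (vorticity i j)" for i j
    unfolding vorticity_def[abs_def] by (intro bracket_Ck_diff bracket_Ck_divide bracket_Ck2_basic)
  then show "bracket_Ck 2 (vorticity i j)" .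
  show "bracket_Ck 2 (vort_vec i)"
    unfolding vort_vec_def[abs_def] by (intro bracket_Ck_cmult bracket_Ck_sum v)
  show "bracket_Ck 2 (grav i)"
    unfolding grav_def[abs_def] by (intro bracket_Ck2_basic)
qed (rule bracket_Ck2_basic)+

lemma bracket_Ck_2_1:
  "bracket_Ck 2 q \<Longrightarrow> bracket_Ck 1 q"
  "bracket_Ck 2 q \<Longrightarrow> bracket_Ck 1 (\<lambda>F. pd i (q F))"
  "bracket_Ck 2 q \<Longrightarrow> bracket_Ck 1 (\<lambda>F. td (q F))"
  using bracket_Ck_decrease[of 1 q] bracket_Ck_pd[of 1 q] bracket_Ck_td[of 1 q]
  by (simp_all add: numeral_2_eq_2)

lemma bracket_Ck_1_0:
  "bracket_Ck 1 q \<Longrightarrow> bracket_Ck 0 (\<lambda>F. pd i (q F))"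
  "bracket_Ck 1 q \<Longrightarrow> bracket_Ck 0 (\<lambda>F. td (q F))"
  by (auto intro!: bracket_Ck_pd[of 0] bracket_Ck_td[of 0])

text \<open>The tidal tensor is linear in second derivatives of the potential. The total
  acceleration contains the product of velocity and velocity gradient, which linear closure does not
  reach, so its regularity is taken from the locale.\<close>

lemma bracket_Ck1_basic: "bracket_Ck 1 density" "bracket_Ck 1 (total_acc i)" "bracket_Ck 1 (tidal i j)"
proof -
  show "bracket_Ck 1 (tidal i j)"
    unfolding tidal_def[abs_def]
    by (intro bracket_Ck_diff bracket_Ck_cmult bracket_Ck_sum bracket_Ck_2_1 bracket_Ck2_basic)
qed (use density_Ck total_acc_Ck in \<open>simp_all add: bracket_Ck_def\<close>)

text \<open>First derivatives of the twice differentiable quantities are listed too, so that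
  \<open>B_pd\<close> and \<open>B_td\<close> can bring a second derivative inside the bracket one
  step at a time.\<close>

lemmas bracket_Ck1 = bracket_Ck2[THEN bracket_Ck_2_1(1)] bracket_Ck2[THEN bracket_Ck_2_1(2)]
  bracket_Ck2[THEN bracket_Ck_2_1(3)] bracket_Ck1_basic
lemmas admissible_fields = bracket_Ck1[THEN bracket_Ck_admissible]
  bracket_Ck1[THEN bracket_Ck_1_0(1), THEN bracket_Ck_admissible]
  bracket_Ck1[THEN bracket_Ck_1_0(2), THEN bracket_Ck_admissible]

lemma admissible_moment: "(q, r) \<in> moment_factors \<Longrightarrow> admissible (\<lambda>F x t. q F x t * r F x t)"
  using moments[of q r] by (simp add: admissible_def)

lemma admissible_advection: "q \<in> advected \<Longrightarrow> admissible (\<lambda>F x t. \<Sum>k\<in>UNIV. vel k F x t * pd k (q F) x t)"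
  by (intro admissible_sum admissible_moment) (auto simp: moment_factors_def)

lemma admissible_advections:
  "admissible (\<lambda>F x t. \<Sum>k\<in>UNIV. vel k F x t * pd k (expansion F) x t)"
  "admissible (\<lambda>F x t. \<Sum>k\<in>UNIV. vel k F x t * pd k (density F) x t)"
  "admissible (\<lambda>F x t. \<Sum>k\<in>UNIV. vel k F x t * pd k (vort_vec i F) x t)"
  "admissible (\<lambda>F x t. \<Sum>k\<in>UNIV. vel k F x t * pd k (shear i j F) x t)"
  "admissible (\<lambda>F x t. \<Sum>k\<in>UNIV. vel k F x t * pd k (tidal i j F) x t)"
  by (rule admissible_advection, force simp: advected_def)+

lemma admissible_products:
  "admissible (\<lambda>F x t. expansion F x t * expansion F x t)"
  "admissible (\<lambda>F x t. density F x t * expansion F x t)"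
  "admissible (\<lambda>F x t. expansion F x t * shear i j F x t)"
  "admissible (\<lambda>F x t. expansion F x t * tidal i j F x t)"
  "admissible (\<lambda>F x t. density F x t * shear i j F x t)"
  "admissible (\<lambda>F x t. expansion F x t * vort_vec i F x t)"
  "admissible (\<lambda>F x t. vort_vec i F x t * vort_vec j F x t)"
  "admissible (\<lambda>F x t. shear i j F x t * vort_vec k F x t)"
  "admissible (\<lambda>F x t. shear i j F x t * shear k l F x t)"
  "admissible (\<lambda>F x t. shear i j F x t * tidal k l F x t)"
  "admissible (\<lambda>F x t. vorticity i j F x t * tidal k l F x t)"
  by (rule admissible_moment, rule moment_factors_products)+

lemma admissible_quadratic: "admissible shear_sq" "admissible vort_sq"
  unfolding shear_sq_def[abs_def] vort_sq_def[abs_def]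
  by (intro admissible_cmult admissible_sum admissible_products)+

lemmas bracket_linear = admissible_add admissible_diff admissible_minus admissible_cmult
  admissible_cmult_right admissible_divide admissible_const admissible_sum
  B_add B_diff B_minus B_cmult B_cmult_right B_divide B_const B_sum admissible_fields
  admissible_advections admissible_products admissible_quadratic
text \<open>The simplifier pulls linear combinations out of the bracket and moves derivatives into
  it, so an averaged equation and the bracket of the unaveraged one meet in a common form. Products
  of two quantities stay inside, since \<open>B_cmult\<close> accepts only factors independent of
  fluid, position and time; the sums in \<open>admissible_advections\<close> enter as single
  terms.\<close>

lemmas bracket_simps = bracket_linear mat_adv B_pd B_td bracket_Ck1

section \<open>The averaged equations, one at a time\<close>

lemma averaged_raychaudhuri:
  assumes "\<And>w. w \<in> space M \<Longrightarrow> raychaudhuri G \<Lambda> (\<lambda>q. q (R w))"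
  shows "raychaudhuri G \<Lambda> B"
  \<comment> \<open>The square becomes a product because \<open>admissible_products\<close> lists
    the moments in that form.\<close>
  unfolding raychaudhuri_def power2_eq_square
proof (intro allI)
  fix x t
  \<comment> \<open>The unaveraged left side is read as one quantity that vanishes on every
    realization. The equations below follow the same template, most of them with a linear expansion
    after this step.\<close>
  have "B (\<lambda>F x t. td (expansion F) x t + (\<Sum>k\<in>UNIV. vel k F x t * pd k (expansion F) x t)
      + 1/3 * (expansion F x t * expansion F x t) + 2 * (shear_sq F x t - vort_sq F x t)
      + 4 * pi * G * density F x t - \<Lambda>
      - (\<Sum>i\<in>UNIV. \<Sum>j\<in>UNIV. kd i j * pd j (total_acc i F) x t)) x t = B (\<lambda>F x t. 0) x t"
    using assms unfolding raychaudhuri_def mat_adv_unaveraged power2_eq_square by (intro B_eqI) blast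
  then show "mat_deriv B expansion x t + adv_corr B expansion x t
     + 1/3 * B (\<lambda>F x t. expansion F x t * expansion F x t) x t
     + 2 * (B shear_sq x t - B vort_sq x t)
     + 4 * pi * G * B density x t - \<Lambda>
     - (\<Sum>i\<in>UNIV. \<Sum>j\<in>UNIV. kd i j * pd j (B (total_acc i)) x t) = 0"
    by (simp only: bracket_simps)
qed

lemma averaged_shear_propagation:
  assumes "\<And>w. w \<in> space M \<Longrightarrow> shear_propagation (\<lambda>q. q (R w))"
  shows "shear_propagation B"
  \<comment> \<open>Unfolding the symmetrization exposes a linear combination to which the bracket
    rules apply.\<close>
  unfolding shear_propagation_def sym2_def
proof (intro allI)
  fix i j x t
  have "B (\<lambda>F x t. td (shear i j F) x t + (\<Sum>k\<in>UNIV. vel k F x t * pd k (shear i j F) x t)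
     + (\<Sum>k\<in>UNIV. \<Sum>l\<in>UNIV. kd k l * (shear i k F x t * shear l j F x t))
     + 2/3 * (expansion F x t * shear i j F x t)
     - 1/3 * kd i j * (2 * shear_sq F x t + vort_sq F x t
         - (\<Sum>k\<in>UNIV. \<Sum>l\<in>UNIV. kd k l * pd l (total_acc k F) x t))
     + vort_vec i F x t * vort_vec j F x t
     + tidal i j F x t
     - (pd j (total_acc i F) x t + pd i (total_acc j F) x t) / 2) x t = B (\<lambda>F x t. 0) x t"
    using assms unfolding shear_propagation_def sym2_def mat_adv_unaveraged by (intro B_eqI) blast
  then show "mat_deriv B (shear i j) x t + adv_corr B (shear i j) x t
     + (\<Sum>k\<in>UNIV. \<Sum>l\<in>UNIV. kd k l * B (\<lambda>F x t. shear i k F x t * shear l j F x t) x t)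
     + 2/3 * B (\<lambda>F x t. expansion F x t * shear i j F x t) x t
     - 1/3 * kd i j * (2 * B shear_sq x t + B vort_sq x t
         - (\<Sum>k\<in>UNIV. \<Sum>l\<in>UNIV. kd k l * pd l (B (total_acc k)) x t))
     + B (\<lambda>F x t. vort_vec i F x t * vort_vec j F x t) x t
     + B (tidal i j) x t
     - (pd j (B (total_acc i)) x t + pd i (B (total_acc j)) x t) / 2 = 0"
    by (simp only: bracket_simps)
qed

lemma averaged_vorticity_propagation:
  assumes "\<And>w. w \<in> space M \<Longrightarrow> vorticity_propagation (\<lambda>q. q (R w))"
  shows "vorticity_propagation B"
  unfolding vorticity_propagation_def
proof (intro allI)
  fix i x t
  have "B (\<lambda>F x t. td (vort_vec i F) x t + (\<Sum>k\<in>UNIV. vel k F x t * pd k (vort_vec i F) x t)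
     + 2/3 * (expansion F x t * vort_vec i F x t)
     - (\<Sum>j\<in>UNIV. kd i j * (\<Sum>k\<in>UNIV. shear j k F x t * vort_vec k F x t))
     - 1/2 * (\<Sum>j\<in>UNIV. \<Sum>k\<in>UNIV. eps i j k * pd k (total_acc j F) x t)) x t
     = B (\<lambda>F x t. 0) x t"
    using assms unfolding vorticity_propagation_def mat_adv_unaveraged by (intro B_eqI) blast
  then show "mat_deriv B (vort_vec i) x t + adv_corr B (vort_vec i) x t
     + 2/3 * B (\<lambda>F x t. expansion F x t * vort_vec i F x t) x t
     - (\<Sum>j\<in>UNIV. kd i j * B (\<lambda>F x t. \<Sum>k\<in>UNIV. shear j k F x t * vort_vec k F x t) x t)
     - 1/2 * (\<Sum>j\<in>UNIV. \<Sum>k\<in>UNIV. eps i j k * pd k (B (total_acc j)) x t) = 0"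
    by (simp only: bracket_simps)
qed

lemma averaged_kinematic_decomposition:
  assumes "\<And>w. w \<in> space M \<Longrightarrow> kinematic_decomposition (\<lambda>q. q (R w))"
  shows "kinematic_decomposition B"
  unfolding kinematic_decomposition_def
proof (intro allI conjI)
  fix i j x t
  have "B (\<lambda>F. pd j (vel i F)) x t
      = B (\<lambda>F x t. shear i j F x t + 1/3 * kd i j * expansion F x t + vorticity i j F x t) x t"
    using assms unfolding kinematic_decomposition_def by (intro B_eqI) blast
  then show "pd j (B (vel i)) x t
      = B (shear i j) x t + 1/3 * kd i j * B expansion x t + B (vorticity i j) x t"
    by (simp only: bracket_simps)
  show "B (shear i j) x t = B (shear j i) x t"
    using assms unfolding kinematic_decomposition_def by (intro B_eqI) blast
  have "B expansion x t = B (\<lambda>F x t. \<Sum>i\<in>UNIV. \<Sum>j\<in>UNIV. kd i j * pd j (vel i F) x t) x t"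
    using assms unfolding kinematic_decomposition_def by (intro B_eqI) blast
  then show "B expansion x t = (\<Sum>i\<in>UNIV. \<Sum>j\<in>UNIV. kd i j * pd j (B (vel i)) x t)"
    by (simp only: bracket_simps)
  have "B (vorticity i j) x t = B (\<lambda>F x t. - vorticity j i F x t) x t"
    using assms unfolding kinematic_decomposition_def by (intro B_eqI) blast
  then show "B (vorticity i j) x t = - B (vorticity j i) x t"
    by (simp only: bracket_simps)
qed

lemma averaged_first_identity:
  assumes "\<And>w. w \<in> space M \<Longrightarrow> first_identity (\<lambda>q. q (R w))"
  shows "first_identity B"
  unfolding first_identity_def
proof (intro allI)
  fix i j x t
  have "B (\<lambda>F. td (pd j (vel i F))) x t = B (\<lambda>F. pd j (td (vel i F))) x t"
    using assms unfolding first_identity_def by (intro B_eqI) blast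
  then show "td (pd j (B (vel i))) x t = pd j (td (B (vel i))) x t"
    by (simp only: bracket_simps)
qed

lemma averaged_second_identity:
  assumes "\<And>w. w \<in> space M \<Longrightarrow> second_identity (\<lambda>q. q (R w))"
  shows "second_identity B"
  unfolding second_identity_def
proof (intro allI)
  fix i j k x t
  have "B (\<lambda>F. pd k (pd j (vel i F))) x t = B (\<lambda>F. pd j (pd k (vel i F))) x t"
    using assms unfolding second_identity_def by (intro B_eqI) blast
  then show "pd k (pd j (B (vel i))) x t = pd j (pd k (B (vel i))) x t"
    by (simp only: bracket_simps)
qed

lemma averaged_first_constraint:
  assumes "\<And>w. w \<in> space M \<Longrightarrow> first_constraint (\<lambda>q. q (R w))"
  shows "first_constraint B"
  unfolding first_constraint_def
proof (intro allI)
  fix i x t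
  have "B (\<lambda>F x t. (\<Sum>j\<in>UNIV. \<Sum>k\<in>UNIV.
        kd j k * (pd k (shear i j F) x t - pd k (vorticity i j F) x t))
      - 2/3 * pd i (expansion F) x t) x t = B (\<lambda>F x t. 0) x t"
    using assms unfolding first_constraint_def by (intro B_eqI) blast
  then show "(\<Sum>j\<in>UNIV. \<Sum>k\<in>UNIV.
        kd j k * (pd k (B (shear i j)) x t - pd k (B (vorticity i j)) x t))
      - 2/3 * pd i (B expansion) x t = 0"
    by (simp only: bracket_simps)
qed

lemma averaged_second_constraint:
  assumes "\<And>w. w \<in> space M \<Longrightarrow> second_constraint (\<lambda>q. q (R w))"
  shows "second_constraint B"
  unfolding second_constraint_def
proof (intro allI)
  fix x t
  have "B (\<lambda>F x t. \<Sum>i\<in>UNIV. pd i (vort_vec i F) x t) x t = B (\<lambda>F x t. 0) x t"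
    using assms unfolding second_constraint_def by (intro B_eqI) blast
  then show "(\<Sum>i\<in>UNIV. pd i (B (vort_vec i)) x t) = 0"
    by (simp only: bracket_simps)
qed

lemma averaged_third_constraint:
  assumes "\<And>w. w \<in> space M \<Longrightarrow> third_constraint (\<lambda>q. q (R w))"
  shows "third_constraint B"
  unfolding third_constraint_def sym2_def
proof (intro allI)
  fix i m x t
  have "B (\<lambda>F x t. ((\<Sum>j\<in>UNIV. \<Sum>k\<in>UNIV. \<Sum>l\<in>UNIV.
        kd j i * (pd l (shear j k F) x t + pd l (vorticity j k F) x t) * eps m k l)
      + (\<Sum>j\<in>UNIV. \<Sum>k\<in>UNIV. \<Sum>l\<in>UNIV.
        kd j m * (pd l (shear j k F) x t + pd l (vorticity j k F) x t) * eps i k l)) / 2) x t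
      = B (\<lambda>F x t. 0) x t"
    using assms unfolding third_constraint_def sym2_def by (intro B_eqI) blast
  then show "((\<Sum>j\<in>UNIV. \<Sum>k\<in>UNIV. \<Sum>l\<in>UNIV.
        kd j i * (pd l (B (shear j k)) x t + pd l (B (vorticity j k)) x t) * eps m k l)
      + (\<Sum>j\<in>UNIV. \<Sum>k\<in>UNIV. \<Sum>l\<in>UNIV.
        kd j m * (pd l (B (shear j k)) x t + pd l (B (vorticity j k)) x t) * eps i k l)) / 2 = 0"
    by (simp only: bracket_simps)
qed

lemma averaged_first_integrability:
  assumes "\<And>w. w \<in> space M \<Longrightarrow> first_integrability G (\<lambda>q. q (R w))"
  shows "first_integrability G B"
  unfolding first_integrability_def
proof (intro allI)
  fix i x t
  have "B (\<lambda>F x t. \<Sum>j\<in>UNIV. pd j (tidal i j F) x t) x t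
      = B (\<lambda>F x t. 8 * pi * G / 3 * pd i (density F) x t) x t"
    using assms unfolding first_integrability_def by (intro B_eqI) blast
  then show "(\<Sum>j\<in>UNIV. pd j (B (tidal i j)) x t) = 8 * pi * G / 3 * pd i (B density) x t"
    by (simp only: bracket_simps)
qed

lemma averaged_second_integrability:
  assumes "\<And>w. w \<in> space M \<Longrightarrow> second_integrability (\<lambda>q. q (R w))"
  shows "second_integrability B"
  unfolding second_integrability_def sym2_def
proof (intro allI)
  fix i l x t
  have "B (\<lambda>F x t. ((\<Sum>j\<in>UNIV. \<Sum>k\<in>UNIV. pd j (tidal k i F) x t * eps l k j)
      + (\<Sum>j\<in>UNIV. \<Sum>k\<in>UNIV. pd j (tidal k l F) x t * eps i k j)) / 2) x t = B (\<lambda>F x t. 0) x t"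
    using assms unfolding second_integrability_def sym2_def by (intro B_eqI) blast
  then show "((\<Sum>j\<in>UNIV. \<Sum>k\<in>UNIV. pd j (B (tidal k i)) x t * eps l k j)
      + (\<Sum>j\<in>UNIV. \<Sum>k\<in>UNIV. pd j (B (tidal k l)) x t * eps i k j)) / 2 = 0"
    by (simp only: bracket_simps)
qed

lemma averaged_third_integrability:
  assumes "\<And>w. w \<in> space M \<Longrightarrow> third_integrability (\<lambda>q. q (R w))"
  shows "third_integrability B"
  unfolding third_integrability_def asym22_def
proof (intro allI)
  fix i j k l x t
  have "B (\<lambda>F x t. (pd l (pd j (shear i k F)) x t - pd l (pd i (shear j k F)) x t
        - pd k (pd j (shear i l F)) x t + pd k (pd i (shear j l F)) x t) / 4
      + 2/3 * ((kd i k * pd l (pd j (expansion F)) x t - kd j k * pd l (pd i (expansion F)) x t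
        - kd i l * pd k (pd j (expansion F)) x t + kd j l * pd k (pd i (expansion F)) x t) / 4)) x t
      = B (\<lambda>F x t. 0) x t"
    using assms unfolding third_integrability_def asym22_def by (intro B_eqI) blast
  then show "(pd l (pd j (B (shear i k))) x t - pd l (pd i (B (shear j k))) x t
        - pd k (pd j (B (shear i l))) x t + pd k (pd i (B (shear j l))) x t) / 4
      + 2/3 * ((kd i k * pd l (pd j (B expansion)) x t - kd j k * pd l (pd i (B expansion)) x t
        - kd i l * pd k (pd j (B expansion)) x t + kd j l * pd k (pd i (B expansion)) x t) / 4) = 0"
    by (simp only: bracket_simps)
qed

lemma averaged_continuity_equation:
  assumes "\<And>w. w \<in> space M \<Longrightarrow> continuity_equation (\<lambda>q. q (R w))"
  shows "continuity_equation B"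
  unfolding continuity_equation_def
proof (intro allI)
  fix x t
  have "B (\<lambda>F x t. td (density F) x t + (\<Sum>k\<in>UNIV. vel k F x t * pd k (density F) x t)
      + density F x t * expansion F x t) x t = B (\<lambda>F x t. 0) x t"
    using assms unfolding continuity_equation_def mat_adv_unaveraged by (intro B_eqI) blast
  then show "mat_deriv B density x t + adv_corr B density x t
      + B (\<lambda>F x t. density F x t * expansion F x t) x t = 0"
    by (simp only: bracket_simps)
qed

lemma averaged_state_equation:
  assumes "\<And>w. w \<in> space M \<Longrightarrow> state_equation \<rho>\<^sub>p (\<lambda>q. q (R w))"
  shows "state_equation \<rho>\<^sub>p B"
  using assms unfolding state_equation_def by (intro allI B_eqI) blast

lemma averaged_navier_stokes:
  assumes "\<And>w. w \<in> space M \<Longrightarrow> navier_stokes (\<lambda>q. q (R w))"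
  shows "navier_stokes B"
  unfolding navier_stokes_def
proof (intro allI)
  fix i x t
  \<comment> \<open>The pressure term is not known to be integrable, so the sign cannot be pulled
    out of its bracket. It is moved to the total acceleration, which is admissible.\<close>
  have "- total_acc i (R w) x t = 1 / density (R w) x t * pd i (pressure (R w)) x t"
    if "w \<in> space M" for w x t
    using assms[OF that] unfolding navier_stokes_def by simp
  then have "B (\<lambda>F x t. - total_acc i F x t) x t
      = B (\<lambda>F x t. 1 / density F x t * pd i (pressure F) x t) x t"
    by (rule B_eqI)
  moreover have "B (\<lambda>F x t. - total_acc i F x t) x t = - B (total_acc i) x t"
    by (simp only: bracket_simps)
  ultimately show
    "B (total_acc i) x t = - B (\<lambda>F x t. 1 / density F x t * pd i (pressure F) x t) x t"
    by simp
qed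

lemma averaged_poisson_equation:
  assumes "\<And>w. w \<in> space M \<Longrightarrow> poisson_equation G \<Lambda> (\<lambda>q. q (R w))"
  shows "poisson_equation G \<Lambda> B"
  unfolding poisson_equation_def
proof (intro allI conjI)
  fix x t
  have "B (\<lambda>F x t. \<Sum>i\<in>UNIV. \<Sum>j\<in>UNIV. kd i j * pd j (grav i F) x t) x t
      = B (\<lambda>F x t. 4 * pi * G * density F x t - \<Lambda>) x t"
    using assms unfolding poisson_equation_def by (intro B_eqI) blast
  then show "(\<Sum>i\<in>UNIV. \<Sum>j\<in>UNIV. kd i j * pd j (B (grav i)) x t)
      = 4 * pi * G * B density x t - \<Lambda>"
    by (simp only: bracket_simps)
  have "B (\<lambda>F x t. \<Sum>i\<in>UNIV. \<Sum>j\<in>UNIV. kd i j * pd j (pd i (potential F)) x t) x t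
      = B (\<lambda>F x t. 4 * pi * G * density F x t - \<Lambda>) x t"
    using assms unfolding poisson_equation_def by (intro B_eqI) blast
  then show "(\<Sum>i\<in>UNIV. \<Sum>j\<in>UNIV. kd i j * pd j (pd i (B potential)) x t)
      = 4 * pi * G * B density x t - \<Lambda>"
    by (simp only: bracket_simps)
qed

lemma averaged_grav_identity:
  assumes "\<And>w. w \<in> space M \<Longrightarrow> grav_identity (\<lambda>q. q (R w))"
  shows "grav_identity B"
  unfolding grav_identity_def
proof (intro allI)
  fix i x t
  have "B (\<lambda>F x t. \<Sum>j\<in>UNIV. \<Sum>k\<in>UNIV. eps i j k * pd k (grav j F) x t) x t
      = B (\<lambda>F x t. 0) x t"
    using assms unfolding grav_identity_def by (intro B_eqI) blast
  then show "(\<Sum>j\<in>UNIV. \<Sum>k\<in>UNIV. eps i j k * pd k (B (grav j)) x t) = 0"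
    by (simp only: bracket_simps)
qed

lemma averaged_tidal_tensor:
  assumes "\<And>w. w \<in> space M \<Longrightarrow> tidal_tensor (\<lambda>q. q (R w))"
  shows "tidal_tensor B"
  unfolding tidal_tensor_def
proof (intro allI conjI)
  fix i j x t
  have "B (tidal i j) x t = B (\<lambda>F x t. pd j (pd i (potential F)) x t
      - 1/3 * kd i j * (\<Sum>k\<in>UNIV. \<Sum>l\<in>UNIV. kd k l * pd l (pd k (potential F)) x t)) x t"
    using assms unfolding tidal_tensor_def by (intro B_eqI) blast
  then show "B (tidal i j) x t = pd j (pd i (B potential)) x t
      - 1/3 * kd i j * (\<Sum>k\<in>UNIV. \<Sum>l\<in>UNIV. kd k l * pd l (pd k (B potential)) x t)"
    by (simp only: bracket_simps)
  show "B (tidal i j) x t = B (tidal j i) x t"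
    using assms unfolding tidal_tensor_def by (intro B_eqI) blast
  have "B (\<lambda>F x t. \<Sum>k\<in>UNIV. \<Sum>l\<in>UNIV. kd k l * tidal k l F x t) x t = B (\<lambda>F x t. 0) x t"
    using assms unfolding tidal_tensor_def by (intro B_eqI) blast
  then show "(\<Sum>k\<in>UNIV. \<Sum>l\<in>UNIV. kd k l * B (tidal k l) x t) = 0"
    by (simp only: bracket_simps)
qed

lemma averaged_tidal_evolution:
  assumes "\<And>w. w \<in> space M \<Longrightarrow> tidal_evolution G (\<lambda>q. q (R w))"
  shows "tidal_evolution G B"
  unfolding tidal_evolution_def sym2_def
proof (intro allI)
  fix i j x t
  have "B (\<lambda>F x t. td (tidal i j F) x t + (\<Sum>k\<in>UNIV. vel k F x t * pd k (tidal i j F) x t)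
     + expansion F x t * tidal i j F x t
     - kd i j * (\<Sum>k\<in>UNIV. \<Sum>l\<in>UNIV. \<Sum>m\<in>UNIV. \<Sum>n\<in>UNIV.
         kd k n * kd l m * (shear k l F x t * tidal n m F x t))
     - 3 * (\<Sum>k\<in>UNIV. \<Sum>l\<in>UNIV. kd k l *
         ((shear k i F x t * tidal j l F x t + shear k j F x t * tidal i l F x t) / 2))
     - (\<Sum>k\<in>UNIV. \<Sum>l\<in>UNIV. kd k l *
         ((vorticity k i F x t * tidal j l F x t + vorticity k j F x t * tidal i l F x t) / 2))
     + 4 * pi * G * (density F x t * shear i j F x t)) x t = B (\<lambda>F x t. 0) x t"
    using assms unfolding tidal_evolution_def sym2_def mat_adv_unaveraged by (intro B_eqI) blast
  then show "mat_deriv B (tidal i j) x t + adv_corr B (tidal i j) x t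
     + B (\<lambda>F x t. expansion F x t * tidal i j F x t) x t
     - kd i j * (\<Sum>k\<in>UNIV. \<Sum>l\<in>UNIV. \<Sum>m\<in>UNIV. \<Sum>n\<in>UNIV.
         kd k n * kd l m * B (\<lambda>F x t. shear k l F x t * tidal n m F x t) x t)
     - 3 * (\<Sum>k\<in>UNIV. \<Sum>l\<in>UNIV. kd k l *
         B (\<lambda>F x t. (shear k i F x t * tidal j l F x t + shear k j F x t * tidal i l F x t) / 2) x t)
     - (\<Sum>k\<in>UNIV. \<Sum>l\<in>UNIV. kd k l *
         B (\<lambda>F x t. (vorticity k i F x t * tidal j l F x t
           + vorticity k j F x t * tidal i l F x t) / 2) x t)
     + 4 * pi * G * B (\<lambda>F x t. density F x t * shear i j F x t) x t = 0"
    by (simp only: bracket_simps)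
qed

theorem averaged_nsp_system:
  assumes "\<And>w. w \<in> space M \<Longrightarrow> nsp_system G \<Lambda> \<rho>\<^sub>p (\<lambda>q. q (R w))"
  shows "nsp_system G \<Lambda> \<rho>\<^sub>p B"
  using assms unfolding nsp_system_def
  by (intro conjI averaged_raychaudhuri averaged_shear_propagation
      averaged_vorticity_propagation averaged_kinematic_decomposition averaged_first_identity
      averaged_second_identity averaged_first_constraint averaged_second_constraint
      averaged_third_constraint averaged_first_integrability averaged_second_integrability
      averaged_third_integrability averaged_continuity_equation averaged_state_equation
      averaged_navier_stokes averaged_poisson_equation averaged_grav_identity
      averaged_tidal_tensor averaged_tidal_evolution) blast+

theorem averaged_brackets_differentiable: "brackets_differentiable B"
  unfolding brackets_differentiable_def by (intro conjI allI reg_Ck bracket_Ck1 bracket_Ck2)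

end

text \<open>Classes of continuous derivatives, unlike integrable bounds, are closed under products,
  so the total acceleration is covered. For a random fluid this supplies only the half of
  \<open>mean_Ck\<close> that concerns single realizations.\<close>

lemma regular_fluid_Ck:
  assumes "regular_fluid F"
  shows "Ck 2 (vel i F)" "Ck 2 (potential F)" "Ck 1 (density F)" "Ck 2 (expansion F)"
    "Ck 2 (shear i j F)" "Ck 2 (vorticity i j F)" "Ck 2 (vort_vec i F)"
    "Ck 1 (tidal i j F)" "Ck 1 (total_acc i F)"
proof -
  have "Ck (Suc 2) (vel i F)" "Ck (Suc 2) (potential F)" for i
    using assms by (simp_all add: regular_fluid_def)
  note d2 = this[THEN Ck_pd] this[THEN Ck_td] this[THEN Ck_decrease]
  have d1: "Ck 1 f" if "Ck 2 f" for f
    using that by (rule Ck_mono) simp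
  have p1: "Ck 1 (pd i f)" if "Ck 2 f" for f i
    using that Ck_pd[of 1 f i] by (simp add: numeral_2_eq_2)
  show "Ck 2 (vel i F)" "Ck 2 (potential F)"
    by (rule d2)+
  show "Ck 1 (density F)"
    using assms by (simp add: regular_fluid_def)
  show e: "Ck 2 (expansion F)"
    unfolding expansion_def by (intro Ck_sum d2)
  show "Ck 2 (shear i j F)"
    unfolding shear_def by (intro Ck_diff Ck_divide Ck_add Ck_cmult d2 e)
  have v: "Ck 2 (vorticity i j F)" for i j
    unfolding vorticity_def by (intro Ck_diff Ck_divide d2)
  then show "Ck 2 (vorticity i j F)" .
  show "Ck 2 (vort_vec i F)"
    unfolding vort_vec_def by (intro Ck_cmult Ck_sum v)
  show "Ck 1 (tidal i j F)"
    unfolding tidal_def by (intro Ck_diff Ck_cmult Ck_sum p1 d2)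
  show "Ck 1 (total_acc i F)"
    unfolding total_acc_def by (intro Ck_add Ck_sum Ck_mult d1 d2)
qed

text \<open>Continuity of both factors makes every moment integrable over a bounded cell, so the
  space-time average requires no hypothesis on moments.\<close>

lemma moment_factors_continuous:
  assumes "regular_fluid F" "(q, r) \<in> moment_factors"
  shows "Ck 0 (q F)" "Ck 0 (r F)"
proof -
  note C = regular_fluid_Ck[OF assms(1)]
  have adv: "Ck 0 (pd k (q F))" if "q \<in> advected" for q k
  proof -
    have "Ck 1 (q F)"
      using that C by (auto simp: advected_def intro: Ck_mono[where n=2])
    then show ?thesis using Ck_pd[of 0] by simp
  qed
  have C0: "Ck 0 (vel i F)" "Ck 0 (density F)" "Ck 0 (expansion F)" "Ck 0 (shear i j F)"
    "Ck 0 (vorticity i j F)" "Ck 0 (vort_vec i F)" "Ck 0 (tidal i j F)" for i j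
    by (rule Ck_continuous, rule C)+
  have "Ck 0 (q F) \<and> Ck 0 (r F)"
    using assms(2) unfolding moment_factors_def Un_iff UN_iff insert_iff empty_iff prod.inject
    by (elim disjE bexE conjE FalseE) (simp_all only: C0 adv)
  then show "Ck 0 (q F)" "Ck 0 (r F)" by auto
qed

subsection \<open>Ensemble average\<close>

lemma ensemble_averaging:
  assumes M: "prob_space M" and R: "regular_random_fluid M R"
  shows "averaging M R (\<lambda>_. 0) (\<lambda>_. 0) (\<lambda>q. ensemble_avg M (\<lambda>w. q (R w)))"
proof (rule averaging.intro)
  show "prob_space M" by (rule M)
  \<comment> \<open>The average is defined by the law of the value; integrability contains the
    measurability needed to turn it into an expectation.\<close>
  show "ensemble_avg M (\<lambda>w. q (R w)) = mean M (\<lambda>w. translate 0 0 (q (R w)))"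
    if "\<And>x t. integrable M (\<lambda>w. translate 0 0 (q (R w)) x t)" for q
    using that borel_measurable_integrable[of M "\<lambda>w. q (R w) _ _"]
    by (auto simp: fun_eq_iff ensemble_avg_def mean_def translate_def integral_distr)
  \<comment> \<open>The law depends only on values on \<open>space M\<close>, and
    \<open>distr_cong\<close> asks for no measurability.\<close>
  show "ensemble_avg M (\<lambda>w. q (R w)) = ensemble_avg M (\<lambda>w. r (R w))"
    if "\<And>w. w \<in> space M \<Longrightarrow> q (R w) = r (R w)" for q r
    unfolding ensemble_avg_def using that
    by (intro ext arg_cong[where f="\<lambda>N. integral\<^sup>L N _"] distr_cong) auto
  have rf: "regular_fluid (R w)" if "w \<in> space M" for w
    using R that by (simp add: regular_random_fluid_def)
  show "mean_Ck M 3 (\<lambda>w. translate 0 0 (vel i (R w)))" for i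
    using R rf by (simp add: mean_Ck_def regular_random_fluid_def translate_def regular_fluid_def)
  show "mean_Ck M 3 (\<lambda>w. translate 0 0 (potential (R w)))"
    using R rf by (simp add: mean_Ck_def regular_random_fluid_def translate_def regular_fluid_def)
  show "mean_Ck M 1 (\<lambda>w. translate 0 0 (density (R w)))"
    using R rf by (simp add: mean_Ck_def regular_random_fluid_def translate_def regular_fluid_def)
  show "mean_Ck M 1 (\<lambda>w. translate 0 0 (total_acc i (R w)))" for i
    using R rf regular_fluid_Ck(9)
    by (simp add: mean_Ck_def regular_random_fluid_def translate_def)
  show "integrable M (\<lambda>w. translate 0 0 (\<lambda>x t. q (R w) x t * r (R w) x t) x t)"
    if "(q, r) \<in> moment_factors" for q r x t
    using R that by (auto simp: regular_random_fluid_def translate_def)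
qed

subsection \<open>Space-time average\<close>

text \<open>
  The restriction to the cell cannot be replaced by a density vanishing outside it:
  \<open>locally_dominated\<close> requires its bound on the whole of \<open>space M\<close>.
\<close>

definition uniform_displacement :: "real set \<Rightarrow> (real^3) set \<Rightarrow> (real \<times> (real^3)) measure" where
  "uniform_displacement I V = Nonnegative_Lebesgue_Integration.density (restrict_space lborel (I \<times> V))
     (\<lambda>_. ennreal (1 / (measure lborel I * measure lborel V)))"

locale averaging_cell =
  fixes I :: "real set" and V :: "(real^3) set"
  assumes I: "is_interval I" "bounded I" "0 < measure lborel I"
    and V: "V \<in> sets borel" "bounded V" "0 < measure lborel V"
begin

lemma I_borel: "I \<in> sets borel"
  using I(1) by (rule real_interval_borel_measurable)

lemma cell_borel: "I \<times> V \<in> sets borel"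
  using I_borel V(1) by (rule borel_Times)

lemma space_uniform_displacement: "space (uniform_displacement I V) = I \<times> V"
  by (simp add: uniform_displacement_def space_restrict_space)

lemma prob_space_uniform_displacement: "prob_space (uniform_displacement I V)"
proof
  have "emeasure lborel (I \<times> V) = emeasure lborel I * emeasure lborel V"
    using lborel.emeasure_pair_measure_Times[of I lborel V] I_borel V(1) by (simp add: lborel_prod)
  \<comment> \<open>Boundedness makes both measures finite, so the real-valued
    \<open>measure\<close> loses nothing and the normalization gives mass one.\<close>
  also have "\<dots> = ennreal (measure lborel I * measure lborel V)"
    using emeasure_bounded_finite[OF I(2)] emeasure_bounded_finite[OF V(2)]
    by (simp add: emeasure_eq_ennreal_measure ennreal_mult)
  finally have "emeasure (restrict_space lborel (I \<times> V)) (I \<times> V) = ennreal (measure lborel I * measure lborel V)"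
    using cell_borel by (simp add: emeasure_restrict_space)
  then show "emeasure (uniform_displacement I V) (space (uniform_displacement I V)) = 1"
    unfolding space_uniform_displacement using I(3) V(3) cell_borel
    by (simp add: uniform_displacement_def emeasure_density_const sets_restrict_space_iff
        flip: ennreal_mult)
qed

text \<open>This is Fubini on the cell, licensed by the integrability assumption; time is the first
  component because it is the outer integral in \<open>spacetime_avg\<close>.\<close>

lemma spacetime_avg_eq_mean:
  assumes "\<And>x t. T x t = I" "\<And>x t. S x t = V"
    and int: "\<And>x t. integrable (uniform_displacement I V) (\<lambda>w. f (x + snd w) (t + fst w))"
  shows "spacetime_avg T S f = mean (uniform_displacement I V) (\<lambda>w. translate (snd w) (fst w) f)"
proof (intro ext)
  fix x t
  define c where "c = 1 / (measure lborel I * measure lborel V)"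
  have c: "c > 0" using I(3) V(3) by (simp add: c_def)
  let ?N = "restrict_space lborel (I \<times> V)" and ?g = "\<lambda>w. f (x + snd w) (t + fst w)"
  have m: "?g \<in> borel_measurable ?N"
    using borel_measurable_integrable[OF int[of x t]]
    by (simp add: uniform_displacement_def)
  have "integrable ?N (\<lambda>w. c * ?g w)"
    using int[of x t] m c
    unfolding uniform_displacement_def c_def[symmetric] by (subst (asm) integrable_real_density) auto
  then have "integrable ?N ?g"
    using c by simp
  \<comment> \<open>Extension by zero beyond the cell gives an integrand on the full product of
    Lebesgue measures, where Fubini is available.\<close>
  then have i: "integrable (lborel \<Otimes>\<^sub>M lborel) (\<lambda>w. indicator (I \<times> V) w *\<^sub>R ?g w)"
    using cell_borel by (subst (asm) integrable_restrict_space) (auto simp: lborel_prod)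
  have "mean (uniform_displacement I V) (\<lambda>w. translate (snd w) (fst w) f) x t = (\<integral>w. c * ?g w \<partial>?N)"
    unfolding mean_def translate_def uniform_displacement_def c_def[symmetric]
    using m c by (subst integral_real_density) auto
  also have "\<dots> = c * (\<integral>w. indicator (I \<times> V) w *\<^sub>R ?g w \<partial>(lborel \<Otimes>\<^sub>M lborel))"
    using cell_borel by (simp add: integral_restrict_space lborel_prod)
  also have "\<dots> = c * (\<integral>t'. \<integral>x'. indicator (I \<times> V) (t', x') *\<^sub>R ?g (t', x') \<partial>lborel \<partial>lborel)"
    using lborel_pair.integral_fst'[OF i] by simp
  also have "\<dots> = spacetime_avg T S f x t"
    by (simp add: spacetime_avg_def assms(1,2) c_def set_lebesgue_integral_def indicator_times mult.assoc)
  finally show "spacetime_avg T S f x t =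
      mean (uniform_displacement I V) (\<lambda>w. translate (snd w) (fst w) f) x t" ..
qed

text \<open>Points within distance 1, displaced by a bounded cell, stay in a compact ball where the
  continuous \<open>f\<close> is bounded; the constant bound is integrable for a probability
  measure.\<close>

lemma locally_dominated_displacement:
  assumes "Ck 0 f"
  shows "locally_dominated (uniform_displacement I V) (\<lambda>w. translate (snd w) (fst w) f)"
  unfolding locally_dominated_def
proof (intro allI conjI)
  fix x t
  interpret prob_space "uniform_displacement I V" by (rule prob_space_uniform_displacement)
  have cont: "continuous_on A (\<lambda>z. f (fst z) (snd z))" for A
    using assms by (auto simp: case_prod_unfold intro: continuous_on_subset)
  have "continuous_on UNIV (\<lambda>w. f (fst (x + snd w, t + fst w)) (snd (x + snd w, t + fst w)))"
    by (rule continuous_on_compose2[OF cont[of UNIV]]) (auto intro!: continuous_intros)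
  then have "(\<lambda>w. f (x + snd w) (t + fst w)) \<in> borel_measurable borel"
    by (simp add: borel_measurable_continuous_onI)
  then show "(\<lambda>w. translate (snd w) (fst w) f x t) \<in> borel_measurable (uniform_displacement I V)"
    by (simp add: uniform_displacement_def translate_def measurable_restrict_space1)
  obtain CI CV where CI: "\<And>s. s \<in> I \<Longrightarrow> norm s \<le> CI" and CV: "\<And>y. y \<in> V \<Longrightarrow> norm y \<le> CV"
    using I(2) V(2) by (auto simp: bounded_iff)
  \<comment> \<open>The bounds for the space and time components are added, as
    \<open>norm_Pair_le\<close> requires; each 1 is the radius of the neighbourhood.\<close>
  define C where "C = norm x + 1 + CV + (norm t + 1 + CI)"
  have "bounded ((\<lambda>z. f (fst z) (snd z)) ` cball 0 C)"
    by (intro compact_imp_bounded compact_continuous_image cont) auto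
  then obtain K where "\<forall>z\<in>cball 0 C. norm (f (fst z) (snd z)) \<le> K"
    unfolding bounded_iff by blast
  then have K: "\<bar>f (fst z) (snd z)\<bar> \<le> K" if "norm z \<le> C" for z
    using that by (simp only: mem_cball_0 real_norm_def Ball_def)
  have "\<bar>translate (snd w) (fst w) f y s\<bar> \<le> K"
    if "w \<in> space (uniform_displacement I V)" "dist y x < 1" "dist s t < 1" for w y s
  proof -
    have "norm (y + snd w) \<le> norm x + 1 + CV"
      using that CV[of "snd w"] norm_triangle_ineq[of y "snd w"] norm_triangle_ineq2[of y x]
      by (auto simp: space_uniform_displacement dist_norm)
    moreover have "norm (s + fst w) \<le> norm t + 1 + CI"
      using that CI[of "fst w"] by (auto simp: space_uniform_displacement dist_norm)
    ultimately have "norm (y + snd w, s + fst w) \<le> C"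
      unfolding C_def by (intro order_trans[OF norm_Pair_le] add_mono)
    from K[OF this] show ?thesis by (simp add: translate_def)
  qed
  then show "\<exists>r>0. \<exists>Z. integrable (uniform_displacement I V) Z \<and>
      (\<forall>w\<in>space (uniform_displacement I V). \<forall>y s. dist y x < r \<longrightarrow> dist s t < r \<longrightarrow>
        \<bar>translate (snd w) (fst w) f y s\<bar> \<le> Z w)"
    by (intro exI[of _ 1] conjI exI[of _ "\<lambda>_. K"]) auto
qed

lemma mean_Ck_displacement:
  "Ck n f \<Longrightarrow> mean_Ck (uniform_displacement I V) n (\<lambda>w. translate (snd w) (fst w) f)"
proof (induction n arbitrary: f)
  case 0
  then show ?case
    by (simp add: mean_Ck_def dominated_Ck.simps locally_dominated_displacement Ck_translate del: Ck.simps)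
next
  case (Suc n)
  have "mean_Ck (uniform_displacement I V) 0 (\<lambda>w. translate (snd w) (fst w) f)"
    using Ck_continuous[OF Suc.prems]
    by (simp add: mean_Ck_def dominated_Ck.simps locally_dominated_displacement Ck_translate del: Ck.simps)
  with Suc show ?case
    by (simp add: mean_Ck_Suc Ck_Suc dd_translate line_diff_translate del: Ck.simps)
qed

lemma spacetime_averaging:
  assumes "\<And>x t. T x t = I" "\<And>x t. S x t = V" and F: "regular_fluid F"
  shows "averaging (uniform_displacement I V) (\<lambda>_. F) snd fst (\<lambda>q. spacetime_avg T S (q F))"
proof (rule averaging.intro)
  show "prob_space (uniform_displacement I V)" by (rule prob_space_uniform_displacement)
  show "spacetime_avg T S (q F) = mean (uniform_displacement I V) (\<lambda>w. translate (snd w) (fst w) (q F))"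
    if "\<And>x t. integrable (uniform_displacement I V) (\<lambda>w. translate (snd w) (fst w) (q F) x t)" for q
    using that by (intro spacetime_avg_eq_mean assms) (simp add: translate_def)
  show "spacetime_avg T S (q F) = spacetime_avg T S (r F)"
    if "\<And>w. w \<in> space (uniform_displacement I V) \<Longrightarrow> q F = r F" for q r
  proof -
    \<comment> \<open>The fluid is the same for every displacement, so a single point of the cell
      already yields \<open>q F = r F\<close>.\<close>
    have "space (uniform_displacement I V) \<noteq> {}"
      by (rule prob_space.not_empty) (rule prob_space_uniform_displacement)
    with that show ?thesis by auto
  qed
  show "integrable (uniform_displacement I V)
      (\<lambda>w. translate (snd w) (fst w) (\<lambda>x t. q F x t * r F x t) x t)"
    if "(q, r) \<in> moment_factors" for q r x t
    using moment_factors_continuous[OF F that]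
    by (intro mean_Ck_integrable[of _ 0] mean_Ck_displacement Ck_mult)
qed (use F regular_fluid_Ck(9)[OF F] in
    \<open>simp_all add: regular_fluid_def mean_Ck_displacement\<close>)

end

theorem theorem6:
  fixes G \<Lambda> :: real and \<rho>\<^sub>p :: "real \<Rightarrow> real"
    and F :: fluid and T :: "real^3 \<Rightarrow> real \<Rightarrow> real set" and S :: "real^3 \<Rightarrow> real \<Rightarrow> (real^3) set"
    and M :: "'w measure" and R :: "'w \<Rightarrow> fluid"
  shows
    "(regular_fluid F \<and> nsp_system G \<Lambda> \<rho>\<^sub>p (\<lambda>q. q F) \<and> covering T S \<longrightarrow>
        brackets_differentiable (\<lambda>q. spacetime_avg T S (q F)) \<and>
        nsp_system G \<Lambda> \<rho>\<^sub>p (\<lambda>q. spacetime_avg T S (q F))) \<and>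
     (prob_space M \<and> regular_random_fluid M R \<and>
      (\<forall>w\<in>space M. nsp_system G \<Lambda> \<rho>\<^sub>p (\<lambda>q. q (R w))) \<longrightarrow>
        brackets_differentiable (\<lambda>q. ensemble_avg M (\<lambda>w. q (R w))) \<and>
        nsp_system G \<Lambda> \<rho>\<^sub>p (\<lambda>q. ensemble_avg M (\<lambda>w. q (R w))))"
proof (intro conjI impI; elim conjE)
  assume F: "regular_fluid F" and sys: "nsp_system G \<Lambda> \<rho>\<^sub>p (\<lambda>q. q F)" and cov: "covering T S"
  \<comment> \<open>The cell at the origin represents all others, because \<open>covering\<close>
    makes them equal in relative coordinates.\<close>
  interpret averaging_cell "T 0 0" "S 0 0"
    using cov by unfold_locales (auto simp: covering_def)
  have "T x t = T 0 0" "S x t = S 0 0" for x t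
    using cov by (auto simp: covering_def)
  from spacetime_averaging[OF this F]
  interpret averaging "uniform_displacement (T 0 0) (S 0 0)" "\<lambda>_. F" snd fst
      "\<lambda>q. spacetime_avg T S (q F)" .
  show "brackets_differentiable (\<lambda>q. spacetime_avg T S (q F))"
    by (rule averaged_brackets_differentiable)
  show "nsp_system G \<Lambda> \<rho>\<^sub>p (\<lambda>q. spacetime_avg T S (q F))"
    by (rule averaged_nsp_system) (rule sys)
next
  assume M: "prob_space M" and R: "regular_random_fluid M R"
    and sys: "\<forall>w\<in>space M. nsp_system G \<Lambda> \<rho>\<^sub>p (\<lambda>q. q (R w))"
  interpret averaging M R "\<lambda>_. 0" "\<lambda>_. 0" "\<lambda>q. ensemble_avg M (\<lambda>w. q (R w))"
    by (rule ensemble_averaging[OF M R])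
  show "brackets_differentiable (\<lambda>q. ensemble_avg M (\<lambda>w. q (R w)))"
    by (rule averaged_brackets_differentiable)
  show "nsp_system G \<Lambda> \<rho>\<^sub>p (\<lambda>q. ensemble_avg M (\<lambda>w. q (R w)))"
    by (rule averaged_nsp_system) (use sys in blast)
qed

end
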